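(* Let $n,m\geq1$ and let $X$ be an infinite countable set. Let $c\in\mathbb{F}_{n+1}$ and $d\in\mathbb{F}_{m+1}$ be cyclically reduced non-primitive words (with respect to fixed free bases) such that the exponent sum of some generator occurring in $c$ is zero, and the exponent sum of some generator occurring in $d$ is zero. Then: (1) there exists a transitive, faithful and amenable action of the amalgamated free product $\mathbb{F}_{n+1}\ast_{\langle c=d\rangle}\mathbb{F}_{m+1}$ on $X$; (2) every finite index subgroup of $\mathbb{F}_{n+1}\ast_{\langle c=d\rangle}\mathbb{F}_{m+1}$ admits a transitive, faithful and amenable action on $X$.
   Context: An action of a countable group $\Gamma$ on $X$ is amenable if there is a sequence $(A_k)$ of finite non-empty subsets of $X$ with $|A_k\triangle gA_k|/|A_k|\to0$ for every $g\in\Gamma$. A word in a free group is non-primitive if it is not part of any free basis. $\mathbb{F}_{n+1}\ast_{\langle c=d\rangle}\mathbb{F}_{m+1}$ is the amalgamated free product identifying $\langle c\rangle$ with $\langle d\rangle$ via $c\mapsto d$. *)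

theory Defs
  imports "HOL-Algebra.Algebra" "HOL-Library.Countable_Set"
begin

text \<open>A letter is a pair (generator, inverted flag); (a, False) is a, (a, True) is a^-1.\<close>

definition inv_letter :: "'g \<times> bool \<Rightarrow> 'g \<times> bool" where
  "inv_letter x = (fst x, \<not> snd x)"

definition inv_word :: "('g \<times> bool) list \<Rightarrow> ('g \<times> bool) list" where
  "inv_word w = rev (map inv_letter w)"

fun reduced :: "('g \<times> bool) list \<Rightarrow> bool" where
  "reduced [] = True"
| "reduced [x] = True"
| "reduced (x # y # zs) = (y \<noteq> inv_letter x \<and> reduced (y # zs))"

definition reduce :: "('g \<times> bool) list \<Rightarrow> ('g \<times> bool) list" where
  "reduce w = foldr (\<lambda>x acc. case acc of [] \<Rightarrow> [x]
                       | y # ys \<Rightarrow> (if y = inv_letter x then ys else x # acc)) w []"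

definition free_group :: "'g set \<Rightarrow> ('g \<times> bool) list monoid" where
  "free_group S = \<lparr> carrier = {w. fst ` set w \<subseteq> S \<and> reduced w},
                    monoid.mult = (\<lambda>u v. reduce (u @ v)),
                    one = [] \<rparr>"

definition eval_word :: "('a, 'm) monoid_scheme \<Rightarrow> ('g \<Rightarrow> 'a) \<Rightarrow> ('g \<times> bool) list \<Rightarrow> 'a" where
  "eval_word G f w = foldr (\<lambda>x acc. (if snd x then inv\<^bsub>G\<^esub> (f (fst x)) else f (fst x)) \<otimes>\<^bsub>G\<^esub> acc)
                       w \<one>\<^bsub>G\<^esub>"

definition free_basis :: "('a, 'm) monoid_scheme \<Rightarrow> 'a set \<Rightarrow> bool" where
  "free_basis G B \<longleftrightarrow> B \<subseteq> carrier G \<and> generate G B = carrier G \<and>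
     (\<forall>w \<in> carrier (free_group B). eval_word G id w = \<one>\<^bsub>G\<^esub> \<longrightarrow> w = [])"

definition primitive :: "'g set \<Rightarrow> ('g \<times> bool) list \<Rightarrow> bool" where
  "primitive S c \<longleftrightarrow> (\<exists>B. free_basis (free_group S) B \<and> c \<in> B)"

definition cyclically_reduced :: "('g \<times> bool) list \<Rightarrow> bool" where
  "cyclically_reduced w \<longleftrightarrow> reduced w \<and> (w = [] \<or> last w \<noteq> inv_letter (hd w))"

definition exp_sum :: "'g \<Rightarrow> ('g \<times> bool) list \<Rightarrow> int" where
  "exp_sum a w = sum_list (map (\<lambda>x. if fst x = a then (if snd x then -1 else 1) else 0) w)"

definition normal_closure :: "('a, 'm) monoid_scheme \<Rightarrow> 'a set \<Rightarrow> 'a set" where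
  "normal_closure G R = generate G {g \<otimes>\<^bsub>G\<^esub> r \<otimes>\<^bsub>G\<^esub> inv\<^bsub>G\<^esub> g | g r. g \<in> carrier G \<and> r \<in> R}"

definition inl_word :: "('a \<times> bool) list \<Rightarrow> (('a + 'b) \<times> bool) list" where
  "inl_word w = map (\<lambda>x. (Inl (fst x), snd x)) w"

definition inr_word :: "('b \<times> bool) list \<Rightarrow> (('a + 'b) \<times> bool) list" where
  "inr_word w = map (\<lambda>x. (Inr (fst x), snd x)) w"

text \<open>F_{n+1} *_{<c = d>} F_{m+1}, with F_{n+1} free on {0..n} and F_{m+1} free on {0..m},
  given by its standard presentation: the free group on the disjoint union of the two
  bases (which is the free product F_{n+1} * F_{m+1}) modulo the normal closure of c d^-1.\<close>
definition amalgam_free ::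
  "nat \<Rightarrow> nat \<Rightarrow> (nat \<times> bool) list \<Rightarrow> (nat \<times> bool) list \<Rightarrow> ((nat + nat) \<times> bool) list set monoid" where
  "amalgam_free n m c d =
     FactGroup (free_group (Inl ` {..n} \<union> Inr ` {..m}))
       (normal_closure (free_group (Inl ` {..n} \<union> Inr ` {..m}))
         {inl_word c \<otimes>\<^bsub>free_group (Inl ` {..n} \<union> Inr ` {..m})\<^esub>
            inv\<^bsub>free_group (Inl ` {..n} \<union> Inr ` {..m})\<^esub> (inr_word d)})"

definition amenable_action :: "('a, 'm) monoid_scheme \<Rightarrow> 'x set \<Rightarrow> ('a \<Rightarrow> 'x \<Rightarrow> 'x) \<Rightarrow> bool" where
  "amenable_action G \<Omega> \<phi> \<longleftrightarrow>
     (\<exists>A :: nat \<Rightarrow> 'x set. (\<forall>k. finite (A k) \<and> A k \<noteq> {} \<and> A k \<subseteq> \<Omega>) \<and>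
        (\<forall>g \<in> carrier G.
           (\<lambda>k. real (card ((A k - \<phi> g ` A k) \<union> (\<phi> g ` A k - A k))) / real (card (A k)))
             \<longlonglongrightarrow> 0))"

definition transitive_faithful_amenable ::
  "('a, 'm) monoid_scheme \<Rightarrow> 'x set \<Rightarrow> ('a \<Rightarrow> 'x \<Rightarrow> 'x) \<Rightarrow> bool" where
  "transitive_faithful_amenable G \<Omega> \<phi> \<longleftrightarrow>
     transitive_action G \<Omega> \<phi> \<and> faithful_action G \<Omega> \<phi> \<and> amenable_action G \<Omega> \<phi>"

end

theory Submission
  imports Defs
begin

text \<open>Let \<open>G\<close> be the amalgam, \<open>a\<close> a generator of exponent sum zero in \<open>c\<close>, and \<open>e : G \<rightarrow> \<int>\<close> the exponent sum
  in \<open>a\<close>. Let \<open>B\<close> be the subgroup generated by all \<open>a\<^sup>l s a\<^sup>-\<^sup>l\<close> with \<open>l \<ge> 0\<close> and \<open>s\<close> another generator. Every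
  element of the kernel of \<open>e\<close> is conjugated into \<open>B\<close> by all large powers of \<open>a\<close>, so it fixes the points
  \<open>a\<^sup>-\<^sup>j B\<close> of \<open>G/B\<close> with \<open>j\<close> large, whereas \<open>a\<close> shifts them: long intervals of these points form a Folner
  sequence, also for the orbit of \<open>B\<close> under a subgroup of finite index. That action is faithful because
  no \<open>g \<noteq> 1\<close> lies in \<open>a\<^sup>k B a\<^sup>-\<^sup>k\<close> for arbitrarily large \<open>k\<close>. To see this, let \<open>G\<close> act on \<open>\<int> \<times> \<nat>\<close> with \<open>a\<close> raising
  the level, regularly at high levels, and with all other generators trivial at low levels. In between,
  \<open>c\<close> acts through some element of the free left factor, and the action of the right factor must
  be chosen so that \<open>d\<close> acts likewise; this is possible because any two permutations
  with infinitely many cycles, all of them infinite, are conjugate.\<close>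

section \<open>Free groups\<close>

text \<open>Left multiplication of a reduced word by one letter. Since \<open>reduce\<close> folds
  it over a word, reduction is studied through the action of letters on reduced words.\<close>

definition push :: "'g \<times> bool \<Rightarrow> ('g \<times> bool) list \<Rightarrow> ('g \<times> bool) list" where
  "push x w = (case w of [] \<Rightarrow> [x] | y # ys \<Rightarrow> (if y = inv_letter x then ys else x # w))"

abbreviation words :: "'g set \<Rightarrow> ('g \<times> bool) list set" where
  "words S \<equiv> lists (S \<times> UNIV)"

lemma reduce_eq_foldr_push:
  fixes w :: "('g \<times> bool) list"
  shows "reduce w = foldr push w []"
proof -
  have "push = (\<lambda>(x :: 'g \<times> bool) acc. case acc of [] \<Rightarrow> [x]
                       | y # ys \<Rightarrow> (if y = inv_letter x then ys else x # acc))"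
    by (intro ext) (auto simp: push_def split: list.split)
  then show ?thesis by (simp only: reduce_def)
qed

lemma reduce_Nil [simp]: "reduce [] = []"
  by (simp add: reduce_eq_foldr_push)

lemma reduce_Cons: "reduce (x # w) = push x (reduce w)"
  by (simp add: reduce_eq_foldr_push)

lemma inv_letter_inv_letter [simp]: "inv_letter (inv_letter x) = x"
  by (simp add: inv_letter_def)

lemma inv_letter_Pair [simp]: "inv_letter (s, b) = (s, \<not> b)"
  by (simp add: inv_letter_def)

lemma reduced_Cons: "reduced (x # w) \<longleftrightarrow> reduced w \<and> (w = [] \<or> hd w \<noteq> inv_letter x)"
  by (cases w) auto

lemma reduced_push: "reduced w \<Longrightarrow> reduced (push x w)"
  by (auto simp: push_def reduced_Cons split: list.splits)

text \<open>Reducedness matters when the inner \<open>push\<close> strips a leading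
  \<open>x\<close>: the letter after it is not the inverse of \<open>x\<close>, so the outer
  \<open>push\<close> puts \<open>x\<close> back. Thus letters act on reduced words by
  permutations.\<close>

lemma push_push_inv_letter: "reduced w \<Longrightarrow> push x (push (inv_letter x) w) = w"
  by (auto simp: push_def reduced_Cons split: list.splits)

lemma reduced_foldr_push: "reduced v \<Longrightarrow> reduced (foldr push u v)"
  by (induction u) (simp_all add: reduced_push)

lemma reduced_reduce [simp]: "reduced (reduce w)"
  by (simp add: reduce_eq_foldr_push reduced_foldr_push)

lemma push_reduced: "reduced (x # w) \<Longrightarrow> push x w = x # w"
  by (auto simp: push_def reduced_Cons split: list.splits)

lemma reduce_reduced: "reduced w \<Longrightarrow> reduce w = w"
  by (induction w) (auto simp: reduce_Cons push_reduced, simp add: push_reduced reduced_Cons)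

text \<open>Cancelling a letter against its inverse removes two permutations that undo each other,
  so the action of a word depends only on its reduced form. Associativity of the free group follows
  from this.\<close>

lemma foldr_push_reduce: "reduced v \<Longrightarrow> foldr push (reduce u) v = foldr push u v"
proof (induction u)
  case (Cons x u)
  show ?case
  proof (cases "reduce u")
    case Nil
    then have "foldr push u v = v" using Cons by simp
    then show ?thesis by (simp add: Nil reduce_Cons push_def[of x "[]"])
  next
    case (Cons y ys)
    have *: "foldr push u v = push y (foldr push ys v)"
      using Cons.IH Cons.prems \<open>reduce u = y # ys\<close> by simp
    show ?thesis
    proof (cases "y = inv_letter x")
      case True
      then show ?thesis
        using * Cons Cons.prems push_def[of x "y # ys"]
        by (simp add: reduce_Cons push_push_inv_letter reduced_foldr_push)
    next
      case False
      then show ?thesis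
        using * Cons push_def[of x "y # ys"] by (simp add: reduce_Cons)
    qed
  qed
qed simp

lemma reduce_append: "reduce (u @ v) = foldr push u (reduce v)"
  by (simp add: reduce_eq_foldr_push)

lemma reduce_append_reduce: "reduce (reduce u @ v) = reduce (u @ v)" "reduce (u @ reduce v) = reduce (u @ v)"
  by (simp_all add: reduce_append foldr_push_reduce reduce_reduced)

lemma inv_word_Nil [simp]: "inv_word [] = []"
  by (simp add: inv_word_def)

lemma inv_word_Cons: "inv_word (x # w) = inv_word w @ [inv_letter x]"
  by (simp add: inv_word_def)

lemma reduce_append_cancel: "reduce (u @ x # inv_letter x # v) = reduce (u @ v)"
  using push_push_inv_letter[OF reduced_reduce, of x v]
  by (simp add: reduce_append reduce_Cons)

lemma reduce_inv_word: "reduce (inv_word w @ w) = []"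
proof (induction w)
  case (Cons x w)
  then show ?case
    using reduce_append_cancel[of "inv_word w" "inv_letter x" w] by (simp add: inv_word_Cons)
qed simp

lemma words_iff: "w \<in> words S \<longleftrightarrow> fst ` set w \<subseteq> S"
  by (auto simp: in_lists_conv_set)

lemma set_push: "set (push x w) \<subseteq> insert x (set w)"
  by (auto simp: push_def split: list.splits if_splits)

lemma set_reduce: "set (reduce w) \<subseteq> set w"
proof (induction w)
  case (Cons x w)
  then show ?case using set_push[of x "reduce w"] by (auto simp: reduce_Cons)
qed simp

lemma reduce_in_words: "w \<in> words S \<Longrightarrow> reduce w \<in> words S"
  using set_reduce[of w] by (auto simp: words_iff)

lemma inv_word_in_words: "w \<in> words S \<Longrightarrow> inv_word w \<in> words S"
  by (force simp: words_iff inv_word_def)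

lemma carrier_free_group: "carrier (free_group S) = {w \<in> words S. reduced w}"
  by (auto simp: free_group_def words_iff)

lemma mult_free_group [simp]: "u \<otimes>\<^bsub>free_group S\<^esub> v = reduce (u @ v)"
  by (simp add: free_group_def)

lemma one_free_group [simp]: "\<one>\<^bsub>free_group S\<^esub> = []"
  by (simp add: free_group_def)

lemma free_group_is_group: "group (free_group S)"
proof (rule groupI)
  fix x assume "x \<in> carrier (free_group S)"
  then show "\<exists>y\<in>carrier (free_group S). y \<otimes>\<^bsub>free_group S\<^esub> x = \<one>\<^bsub>free_group S\<^esub>"
    by (intro bexI[of _ "reduce (inv_word x)"])
      (auto simp: carrier_free_group reduce_append_reduce reduce_inv_word reduce_in_words inv_word_in_words)
qed (auto simp: carrier_free_group reduce_append_reduce reduce_in_words reduce_reduced)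

section \<open>Evaluating words in a group\<close>

lemma eval_word_Nil [simp]: "eval_word G f [] = \<one>\<^bsub>G\<^esub>"
  by (simp add: eval_word_def)

lemma eval_word_Cons:
  "eval_word G f (x # w) = (if snd x then inv\<^bsub>G\<^esub> (f (fst x)) else f (fst x)) \<otimes>\<^bsub>G\<^esub> eval_word G f w"
  by (simp add: eval_word_def)

context group
begin

lemma eval_word_closed: "w \<in> words S \<Longrightarrow> f \<in> S \<rightarrow> carrier G \<Longrightarrow> eval_word G f w \<in> carrier G"
  by (induction w) (auto simp: eval_word_Cons Pi_iff)

lemma eval_word_append:
  "u \<in> words S \<Longrightarrow> v \<in> words S \<Longrightarrow> f \<in> S \<rightarrow> carrier G \<Longrightarrow>
    eval_word G f (u @ v) = eval_word G f u \<otimes> eval_word G f v"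
proof (induction u)
  case Nil
  then show ?case by (simp add: eval_word_closed)
next
  case (Cons x u)
  then have "f (fst x) \<in> carrier G" by (auto simp: Pi_iff)
  moreover have "eval_word G f u \<in> carrier G" "eval_word G f v \<in> carrier G"
    using Cons.prems by (auto intro: eval_word_closed)
  ultimately show ?case using Cons by (auto simp: eval_word_Cons m_assoc)
qed

lemma eval_word_push:
  assumes "x \<in> S \<times> UNIV" "w \<in> words S" "f \<in> S \<rightarrow> carrier G"
  shows "eval_word G f (push x w) = eval_word G f (x # w)"
proof (cases "\<exists>ys. w = inv_letter x # ys")
  case True
  then obtain ys where ys: "w = inv_letter x # ys" by blast
  have f: "f (fst x) \<in> carrier G" "eval_word G f ys \<in> carrier G"
    using assms ys by (auto simp: Pi_iff intro: eval_word_closed)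
  then show ?thesis
    by (auto simp: ys push_def eval_word_Cons inv_letter_def simp flip: m_assoc)
next
  case False
  then show ?thesis by (auto simp: push_def split: list.splits)
qed

lemma eval_word_reduce:
  "w \<in> words S \<Longrightarrow> f \<in> S \<rightarrow> carrier G \<Longrightarrow> eval_word G f (reduce w) = eval_word G f w"
proof (induction w)
  case (Cons x w)
  then have "eval_word G f (push x (reduce w)) = eval_word G f (x # reduce w)"
    by (intro eval_word_push[of _ S]) (auto simp: reduce_in_words)
  with Cons show ?case by (simp add: reduce_Cons eval_word_Cons)
qed simp

lemma eval_word_hom: "f \<in> S \<rightarrow> carrier G \<Longrightarrow> eval_word G f \<in> hom (free_group S) G"
  by (auto simp: hom_def carrier_free_group eval_word_closed[of _ S] eval_word_append[of _ S] eval_word_reduce[of _ S])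

end

lemma hom_eval_word:
  assumes "group G" "group H" "h \<in> hom G H" "w \<in> words S" "f \<in> S \<rightarrow> carrier G"
  shows "h (eval_word G f w) = eval_word H (\<lambda>s. h (f s)) w"
  using assms(4)
proof (induction w)
  case Nil
  then show ?case using assms by (simp add: hom_one)
next
  case (Cons x w)
  interpret group_hom G H h using assms by (simp add: group_hom_def group_hom_axioms_def)
  have "f (fst x) \<in> carrier G" "eval_word G f w \<in> carrier G"
    using Cons assms by (auto simp: Pi_iff intro: G.eval_word_closed)
  then show ?case using Cons by (auto simp: eval_word_Cons)
qed

lemma eval_word_map:
  "eval_word G f (map (\<lambda>x. (h (fst x), snd x)) w) = eval_word G (\<lambda>s. f (h s)) w"
  by (induction w) (auto simp: eval_word_Cons)

lemma inv_free_group: "w \<in> carrier (free_group S) \<Longrightarrow> inv\<^bsub>free_group S\<^esub> w = reduce (inv_word w)"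
  by (rule group.inv_equality[OF free_group_is_group])
    (simp_all add: carrier_free_group reduce_append_reduce reduce_inv_word reduce_in_words inv_word_in_words)

text \<open>Together with \<open>hom_eval_word\<close> this computes a homomorphism on a free group
  from its values on the generators.\<close>

lemma eval_word_free_group:
  "w \<in> words S \<Longrightarrow> eval_word (free_group S) (\<lambda>s. [(s, False)]) w = reduce w"
proof (induction w)
  case (Cons x w)
  then have "[(fst x, False)] \<in> carrier (free_group S)" by (auto simp: carrier_free_group)
  with Cons show ?case
    by (cases x) (auto simp: eval_word_Cons inv_free_group inv_word_Cons reduce_append_reduce reduce_Cons push_def split: list.split)
qed simp

lemma generators_in_free_group: "(\<lambda>s. [(s, False)]) \<in> S \<rightarrow> carrier (free_group S)"
  by (auto simp: carrier_free_group)

section \<open>Powers and torsion in free groups\<close>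

lemma reduced_append:
  "reduced (u @ v) \<longleftrightarrow> reduced u \<and> reduced v \<and> (u = [] \<or> v = [] \<or> hd v \<noteq> inv_letter (last u))"
proof (induction u)
  case (Cons x u)
  then show ?case by (cases u) (auto simp: reduced_Cons)
qed simp

lemma pow_free_group:
  "w \<in> carrier (free_group S) \<Longrightarrow> w [^]\<^bsub>free_group S\<^esub> k = reduce (concat (replicate k w))"
proof (induction k)
  case (Suc k)
  have "concat (replicate k w) @ w = w @ concat (replicate k w)"
    by (induction k) auto
  with Suc show ?case by (simp add: nat_pow_def reduce_append_reduce)
qed (simp add: nat_pow_def)

text \<open>At each seam the last letter of \<open>w\<close> meets the first one, and cyclic
  reducedness forbids exactly this cancellation.\<close>

lemma reduced_concat_replicate:
  assumes "cyclically_reduced w" "w \<noteq> []"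
  shows "reduced (concat (replicate k w))"
proof (induction k)
  case (Suc k)
  have "concat (replicate k w) = [] \<or> hd (concat (replicate k w)) = hd w"
    using assms by (cases k) auto
  then show ?case
    using Suc assms by (auto simp: reduced_append cyclically_reduced_def)
qed simp

lemma (in group) inv_mult_cancel:
  assumes "x \<in> carrier G" "y \<in> carrier G"
  shows "inv x \<otimes> (x \<otimes> y) = y" "x \<otimes> (inv x \<otimes> y) = y"
  using assms by (simp_all flip: m_assoc)

lemma (in group) pow_conjugate:
  assumes "x \<in> carrier G" "y \<in> carrier G"
  shows "(x \<otimes> y \<otimes> inv x) [^] (k::nat) = x \<otimes> y [^] k \<otimes> inv x"
proof (induction k)
  case (Suc k)
  then show ?case using assms by (simp add: m_assoc inv_mult_cancel)
qed (use assms in simp)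

text \<open>Torsion is excluded by induction on the length: if \<open>w\<close> is not cyclically reduced, it is
  conjugate to a shorter word; otherwise the concatenation of copies of \<open>w\<close> is already reduced.\<close>

lemma free_group_torsion_free:
  assumes "w \<in> carrier (free_group S)" "w \<noteq> []" "k > 0"
  shows "w [^]\<^bsub>free_group S\<^esub> (k::nat) \<noteq> \<one>\<^bsub>free_group S\<^esub>"
  using assms
proof (induction "length w" arbitrary: w rule: less_induct)
  case less
  interpret group "free_group S" by (rule free_group_is_group)
  show ?case
  proof (cases "cyclically_reduced w")
    case True
    have "reduce (concat (replicate k w)) = concat (replicate k w)"
      using True less.prems by (intro reduce_reduced reduced_concat_replicate)
    moreover have "concat (replicate k w) \<noteq> []"
      using less.prems by (cases k) auto
    ultimately show ?thesis
      using less.prems by (simp add: pow_free_group)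
  next
    case False
    then have last: "last w = inv_letter (hd w)"
      using less.prems by (auto simp: cyclically_reduced_def carrier_free_group)
    \<comment> \<open>A letter is never its own inverse, so \<open>w\<close> has at least two
      letters; as \<open>w\<close> is reduced, the middle part \<open>v\<close> is nonempty
      too.\<close>
    obtain x v where w: "w = x # v @ [inv_letter x]"
      using last less.prems(2)
      by (cases w; cases "tl w" rule: rev_cases) auto
    have v: "v \<in> carrier (free_group S)" "v \<noteq> []" and x: "[x] \<in> carrier (free_group S)"
      using less.prems by (auto simp: carrier_free_group w reduced_append reduced_Cons)
    have inv_x: "inv\<^bsub>free_group S\<^esub> [x] = [inv_letter x]"
      using x by (simp add: inv_free_group inv_word_Cons reduce_reduced)
    have "w = [x] \<otimes>\<^bsub>free_group S\<^esub> v \<otimes>\<^bsub>free_group S\<^esub> inv\<^bsub>free_group S\<^esub> [x]"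
      using less.prems unfolding inv_x by (simp add: reduce_append_reduce w carrier_free_group reduce_reduced)
    moreover have "([x] \<otimes>\<^bsub>free_group S\<^esub> v \<otimes>\<^bsub>free_group S\<^esub> inv\<^bsub>free_group S\<^esub> [x]) [^]\<^bsub>free_group S\<^esub> k =
        [x] \<otimes>\<^bsub>free_group S\<^esub> v [^]\<^bsub>free_group S\<^esub> k \<otimes>\<^bsub>free_group S\<^esub> inv\<^bsub>free_group S\<^esub> [x]"
      using x v by (metis pow_conjugate)
    moreover have "v [^]\<^bsub>free_group S\<^esub> k \<noteq> \<one>\<^bsub>free_group S\<^esub>"
      using less.hyps[of v] v w \<open>k > 0\<close> by simp
    ultimately show ?thesis
      using x v by (metis inv_solve_right' l_one local.nat_pow_closed r_cancel_one' m_closed inv_closed l_cancel_one' r_inv)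
  qed
qed

section \<open>Permutations\<close>

text \<open>All bijections of a whole type, so that products are plain compositions without
  restriction to a carrier set.\<close>

definition perm_group :: "('y \<Rightarrow> 'y) monoid" where
  "perm_group = \<lparr>carrier = {f. bij f}, monoid.mult = (\<circ>), one = id\<rparr>"

lemma perm_group_simps [simp]:
  "f \<in> carrier perm_group \<longleftrightarrow> bij f" "f \<otimes>\<^bsub>perm_group\<^esub> g = f \<circ> g" "\<one>\<^bsub>perm_group\<^esub> = id"
  by (simp_all add: perm_group_def)

lemma group_perm_group: "group perm_group"
proof (rule groupI)
  fix f :: "'y \<Rightarrow> 'y" assume "f \<in> carrier perm_group"
  then show "\<exists>g\<in>carrier perm_group. g \<otimes>\<^bsub>perm_group\<^esub> f = \<one>\<^bsub>perm_group\<^esub>"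
    by (intro bexI[of _ "inv_into UNIV f"]) (auto simp: bij_imp_bij_inv bij_is_inj)
qed (auto simp: bij_comp comp_assoc)

lemma inv_perm_group [simp]: "bij f \<Longrightarrow> inv\<^bsub>perm_group\<^esub> f = inv_into UNIV f"
  by (rule group.inv_equality[OF group_perm_group]) (auto simp: bij_imp_bij_inv bij_is_inj)

lemma pow_perm_group: "f [^]\<^bsub>perm_group\<^esub> (k::nat) = f ^^ k"
  by (induction k) (simp_all add: nat_pow_def funpow_Suc_right del: funpow.simps(2))

lemma eval_perm_group_Cons [simp]:
  "bij (p (fst x)) \<Longrightarrow> eval_word perm_group p (x # w) t =
    (if snd x then inv_into UNIV (p (fst x)) else p (fst x)) (eval_word perm_group p w t)"
  by (simp add: eval_word_Cons)

text \<open>Conjugation by \<open>q\<close> is an endomorphism of \<open>perm_group\<close>, so it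
  commutes with evaluation. This is how an action of the right factor is adjusted to make
  \<open>d\<close> act as prescribed.\<close>

lemma eval_perm_group_conjugate:
  assumes "bij q" "\<And>s. s \<in> S \<Longrightarrow> bij (p s)" "w \<in> words S"
  shows "eval_word perm_group (\<lambda>s. q \<circ> p s \<circ> inv_into UNIV q) w = q \<circ> eval_word perm_group p w \<circ> inv_into UNIV q"
proof -
  have "(\<lambda>f. q \<circ> f \<circ> inv_into UNIV q) \<in> hom perm_group perm_group"
    using assms(1) by (auto simp: hom_def bij_comp bij_imp_bij_inv bij_is_inj fun_eq_iff)
  from hom_eval_word[OF group_perm_group group_perm_group this assms(3), of p]
  show ?thesis using assms(2) by (simp add: Pi_iff)
qed

section \<open>Permutations with infinitely many cycles, all of them infinite\<close>

text \<open>The number of cycles is expressed by a label \<open>\<kappa>\<close> that is constant on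
  each cycle and takes infinitely many values.\<close>

definition multishift :: "(nat \<Rightarrow> nat) \<Rightarrow> bool" where
  "multishift f \<longleftrightarrow> bij f \<and> (\<forall>k>0. \<forall>x. (f ^^ k) x \<noteq> x) \<and>
     (\<exists>\<kappa> :: nat \<Rightarrow> nat. infinite (range \<kappa>) \<and> (\<forall>x. \<kappa> (f x) = \<kappa> x))"

text \<open>Number the cycles, choose a representative on each, and record a point by the number of
  its cycle and its signed distance from the representative. The permutation then becomes the shift
  of the second coordinate of \<nat> \<times> \<int>.\<close>

lemma multishift_normal_form:
  assumes "multishift f"
  obtains \<theta> :: "nat \<Rightarrow> nat \<times> int" where "bij \<theta>" "\<And>x. \<theta> (f x) = (fst (\<theta> x), snd (\<theta> x) + 1)"
proof -
  obtain \<kappa> :: "nat \<Rightarrow> nat" where bij: "bij f" and free: "\<And>k x. k > 0 \<Longrightarrow> (f ^^ k) x \<noteq> x"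
    and \<kappa>: "infinite (range \<kappa>)" "\<And>x. \<kappa> (f x) = \<kappa> x"
    using assms by (auto simp: multishift_def)
  have inj: "(f ^^ k) x = (f ^^ k) y \<Longrightarrow> x = y" for k x y
    using inj_fn[OF bij_is_inj[OF bij], of k] by (auto dest: injD)
  have add: "(f ^^ i) ((f ^^ j) x) = (f ^^ (i + j)) x" for i j x
    by (simp add: funpow_add)
  have comm: "(f ^^ i) ((f ^^ j) x) = (f ^^ j) ((f ^^ i) x)" for i j x
    by (simp only: add add.commute)
  have free': "i = j" if "(f ^^ i) x = (f ^^ j) x" for i j x
  proof (rule ccontr)
    have False if "i < j" "(f ^^ i) x = (f ^^ j) x" for i j
    proof -
      have "(f ^^ i) ((f ^^ (j - i)) x) = (f ^^ i) x" using that by (simp add: add)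
      then have "(f ^^ (j - i)) x = x" by (rule inj)
      then show False using free[of "j - i" x] \<open>i < j\<close> by simp
    qed
    moreover assume "i \<noteq> j"
    ultimately show False using \<open>(f ^^ i) x = (f ^^ j) x\<close> by (metis linorder_neqE_nat)
  qed
  \<comment> \<open>Lying on the same cycle; with a natural exponent on either side no negative
    powers of \<open>f\<close> are needed.\<close>
  define R where "R x y \<longleftrightarrow> (\<exists>i j. (f ^^ i) x = (f ^^ j) y)" for x y
  have R_refl: "R x x" for x unfolding R_def by blast
  have R_sym: "R x y \<Longrightarrow> R y x" for x y unfolding R_def by metis
  have R_trans: "R x z" if "R x y" "R y z" for x y z
  proof -
    obtain i j k l where eq: "(f ^^ i) x = (f ^^ j) y" "(f ^^ k) y = (f ^^ l) z"
      using \<open>R x y\<close> \<open>R y z\<close> by (auto simp: R_def)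
    have "(f ^^ (k + i)) x = (f ^^ k) ((f ^^ j) y)" by (simp only: eq(1) flip: add)
    also have "\<dots> = (f ^^ j) ((f ^^ k) y)" by (rule comm)
    also have "\<dots> = (f ^^ (j + l)) z" by (simp only: eq(2) add)
    finally show ?thesis unfolding R_def by blast
  qed
  have \<kappa>_pow: "\<kappa> ((f ^^ k) x) = \<kappa> x" for k x
    by (induction k) (simp_all add: \<kappa>)
  have \<kappa>_R: "R x y \<Longrightarrow> \<kappa> x = \<kappa> y" for x y
    unfolding R_def by (metis \<kappa>_pow)
  \<comment> \<open>The choice depends only on the cycle, because points on the same cycle have the
    same predicate \<open>R x\<close>.\<close>
  define r where "r x = (SOME y. R x y)" for x
  have R_r: "R x (r x)" for x
    unfolding r_def by (rule someI[of "R x", OF R_refl])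
  have r_eq: "r x = r y" if "R x y" for x y
  proof -
    have "R x = R y" using that R_sym R_trans by blast
    then show ?thesis by (simp add: r_def)
  qed
  \<comment> \<open>The label \<open>\<kappa>\<close> factors through \<open>r\<close>, so there are
    at least as many representatives as labels.\<close>
  have "infinite (range r)"
  proof
    assume "finite (range r)"
    moreover have "range \<kappa> \<subseteq> \<kappa> ` range r"
      using \<kappa>_R[OF R_r] by auto
    ultimately show False using \<kappa>(1) by (meson finite_imageI finite_subset)
  qed
  then obtain \<beta> :: "nat \<Rightarrow> nat" where \<beta>: "bij_betw \<beta> (range r) UNIV"
    using countable_infiniteE'[of "range r"] bij_betw_inv_into by (metis countableI_type)
  \<comment> \<open>The signed distance from the representative. It is independent of
    \<open>i\<close> and \<open>j\<close> because the cycle is infinite, which is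
    \<open>free'\<close>.\<close>
  define pos where "pos x = (SOME z. \<exists>i j. (f ^^ i) x = (f ^^ j) (r x) \<and> z = int j - int i)" for x
  have pos_eq: "pos x = int j - int i" if eq: "(f ^^ i) x = (f ^^ j) (r x)" for x i j
  proof -
    have "\<exists>z i j. (f ^^ i) x = (f ^^ j) (r x) \<and> z = int j - int i"
      using eq by blast
    then have "\<exists>i j. (f ^^ i) x = (f ^^ j) (r x) \<and> pos x = int j - int i"
      unfolding pos_def by (rule someI_ex)
    then obtain k l where kl: "(f ^^ k) x = (f ^^ l) (r x)" "pos x = int l - int k" by blast
    have "(f ^^ (i + l)) (r x) = (f ^^ i) ((f ^^ k) x)" by (simp only: kl(1) flip: add)
    also have "\<dots> = (f ^^ k) ((f ^^ i) x)" by (rule comm)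
    also have "\<dots> = (f ^^ (k + j)) (r x)" by (simp only: eq add)
    finally have "i + l = k + j" by (rule free')
    then show ?thesis using kl(2) by linarith
  qed
  define \<theta> where "\<theta> x = (\<beta> (r x), pos x)" for x
  have "inj \<theta>"
  proof (rule injI)
    fix x y assume "\<theta> x = \<theta> y"
    then have r: "r x = r y" and pos: "pos x = pos y"
      using \<beta> by (auto simp: \<theta>_def bij_betw_def inj_on_def)
    obtain i j k l where eq: "(f ^^ i) x = (f ^^ j) (r x)" "(f ^^ k) y = (f ^^ l) (r y)"
      using R_r[of x] R_r[of y] by (auto simp: R_def)
    have "i + l = k + j" using pos_eq[OF eq(1)] pos_eq[OF eq(2)] pos by linarith
    have "(f ^^ (i + l)) x = (f ^^ l) ((f ^^ i) x)" by (simp only: add add.commute)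
    also have "\<dots> = (f ^^ l) ((f ^^ j) (r x))" by (simp only: eq(1))
    also have "\<dots> = (f ^^ j) ((f ^^ l) (r y))" by (simp only: comm[of l] r)
    also have "\<dots> = (f ^^ (k + j)) y" by (simp only: eq(2)[symmetric] add add.commute)
    also have "k + j = i + l" using \<open>i + l = k + j\<close> ..
    finally show "x = y" by (rule inj)
  qed
  moreover have "surj \<theta>"
  proof -
    have "\<exists>x. \<theta> x = (b, z)" for b z
    proof -
      have "b \<in> \<beta> ` range r" using \<beta> by (simp add: bij_betw_def)
      then obtain y0 where y0: "\<beta> (r y0) = b" by auto
      define y where "y = r y0"
      have ry: "r y = y" using r_eq[OF R_r[of y0]] by (simp add: y_def)
      \<comment> \<open>One of \<open>nat (- z)\<close> and \<open>nat z\<close> is zero, so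
        \<open>x\<close> will be the point at signed distance \<open>z\<close> from
        \<open>y\<close>.\<close>
      have "surj (f ^^ nat (- z))" using bij by (simp add: bij_is_surj)
      then obtain x where x: "(f ^^ nat (- z)) x = (f ^^ nat z) y" by (metis surjD)
      then have "R x y" by (auto simp: R_def)
      then have "r x = y" using r_eq[of x y] ry by simp
      then have "\<theta> x = (b, z)" using pos_eq[of "nat (- z)" x "nat z"] x y0 by (simp add: \<theta>_def y_def)
      then show ?thesis ..
    qed
    then show ?thesis by (metis surj_def surj_pair)
  qed
  moreover have "\<theta> (f x) = (fst (\<theta> x), snd (\<theta> x) + 1)" for x
  proof -
    obtain i j where eq: "(f ^^ i) x = (f ^^ j) (r x)" using R_r[of x] by (auto simp: R_def)
    have "(f ^^ i) (f x) = f ((f ^^ i) x)" by (simp add: funpow_swap1)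
    then have eq': "(f ^^ i) (f x) = (f ^^ Suc j) (r x)" by (simp add: eq)
    have "R (f x) x" unfolding R_def by (intro exI[of _ 0] exI[of _ 1]) simp
    then have "r (f x) = r x" by (rule r_eq)
    then show ?thesis using pos_eq[OF eq] pos_eq[of i "f x" "Suc j"] eq' by (simp add: \<theta>_def)
  qed
  ultimately show ?thesis using that by (simp add: bij_def)
qed

text \<open>Both permutations have the same normal form, the shift of \<nat> \<times>
  \<int>.\<close>

lemma multishift_conjugate:
  assumes "multishift f" "multishift g"
  obtains q where "bij q" "q \<circ> g \<circ> inv_into UNIV q = f"
proof -
  obtain \<theta> :: "nat \<Rightarrow> nat \<times> int" where \<theta>: "bij \<theta>" "\<And>x. \<theta> (f x) = (fst (\<theta> x), snd (\<theta> x) + 1)"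
    using multishift_normal_form[OF assms(1)] by metis
  obtain \<theta>' :: "nat \<Rightarrow> nat \<times> int" where \<theta>': "bij \<theta>'" "\<And>x. \<theta>' (g x) = (fst (\<theta>' x), snd (\<theta>' x) + 1)"
    using multishift_normal_form[OF assms(2)] by metis
  define q where "q = inv_into UNIV \<theta> \<circ> \<theta>'"
  have q: "bij q" using \<theta>(1) \<theta>'(1) by (simp add: q_def bij_comp bij_imp_bij_inv)
  have "\<theta> (q (g x)) = \<theta> (f (q x))" for x
    using \<theta> \<theta>' by (simp add: q_def bij_is_surj surj_f_inv_f)
  then have "q (g x) = f (q x)" for x using \<theta>(1) by (meson bij_is_inj injD)
  then have "q \<circ> g \<circ> inv_into UNIV q = f" using q by (simp add: fun_eq_iff bij_is_surj surj_f_inv_f)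
  with q show ?thesis by (rule that)
qed

section \<open>Free actions with infinitely many orbits\<close>

text \<open>Infinitely many orbits are again witnessed by an invariant label. Being invariant under
  all of \<open>Q\<close>, it also labels the cycles of each single element.\<close>

definition regular_like :: "('q, 'm) monoid_scheme \<Rightarrow> ('q \<Rightarrow> nat \<Rightarrow> nat) \<Rightarrow> bool" where
  "regular_like Q \<Lambda> \<longleftrightarrow> \<Lambda> \<in> hom Q perm_group \<and>
     (\<forall>g\<in>carrier Q. \<forall>x. \<Lambda> g x = x \<longrightarrow> g = \<one>\<^bsub>Q\<^esub>) \<and>
     (\<exists>\<kappa> :: nat \<Rightarrow> nat. infinite (range \<kappa>) \<and> (\<forall>g\<in>carrier Q. \<forall>x. \<kappa> (\<Lambda> g x) = \<kappa> x))"

text \<open>The left regular representation, taken with countably infinite multiplicity.\<close>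

lemma (in group) ex_regular_like:
  assumes "countable (carrier G)"
  shows "\<exists>\<Lambda>. regular_like G \<Lambda>"
proof -
  \<comment> \<open>The factor \<nat> makes \<open>Y\<close> infinite even if the group is finite,
    and its coordinate serves as the orbit label.\<close>
  define Y where "Y = carrier G \<times> (UNIV :: nat set)"
  have Y: "countable Y" "infinite Y" "Y \<noteq> {}"
    using assms by (auto simp: Y_def finite_cartesian_product_iff)
  define enc where "enc = to_nat_on Y"
  define dec where "dec = from_nat_into Y"
  have enc_dec: "enc (dec i) = i" for i using Y by (simp add: enc_def dec_def)
  have dec_enc: "x \<in> Y \<Longrightarrow> dec (enc x) = x" for x using Y by (simp add: enc_def dec_def)
  have dec_in: "dec i \<in> Y" for i using Y by (simp add: dec_def from_nat_into)
  have fst_in: "fst (dec i) \<in> carrier G" for i using dec_in[of i] by (auto simp: Y_def)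
  define \<Lambda> where "\<Lambda> g i = enc (g \<otimes> fst (dec i), snd (dec i))" for g i
  have dec_\<Lambda>: "dec (\<Lambda> g i) = (g \<otimes> fst (dec i), snd (dec i))" if "g \<in> carrier G" for g i
    using that fst_in[of i] by (simp add: \<Lambda>_def dec_enc Y_def)
  have mult: "\<Lambda> (g \<otimes> h) = \<Lambda> g \<circ> \<Lambda> h" if "g \<in> carrier G" "h \<in> carrier G" for g h
  proof
    fix i
    have "\<Lambda> (g \<otimes> h) i = enc (g \<otimes> (h \<otimes> fst (dec i)), snd (dec i))"
      using that by (simp add: \<Lambda>_def m_assoc fst_in)
    also have "\<dots> = \<Lambda> g (\<Lambda> h i)"
      using that by (simp add: \<Lambda>_def[of g "\<Lambda> h i"] dec_\<Lambda>)
    finally show "\<Lambda> (g \<otimes> h) i = (\<Lambda> g \<circ> \<Lambda> h) i" by simp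
  qed
  have one: "\<Lambda> \<one> = id"
    using fst_in by (simp add: \<Lambda>_def fun_eq_iff enc_dec)
  have "bij (\<Lambda> g)" if "g \<in> carrier G" for g
  proof (rule o_bij)
    show "\<Lambda> (inv g) \<circ> \<Lambda> g = id" "\<Lambda> g \<circ> \<Lambda> (inv g) = id"
      using that by (simp_all add: one flip: mult)
  qed
  then have "\<Lambda> \<in> hom G perm_group" by (simp add: hom_def mult)
  moreover have "g = \<one>" if "g \<in> carrier G" "\<Lambda> g i = i" for g i
    proof -
    have "g \<otimes> fst (dec i) = fst (dec i)"
      using dec_\<Lambda>[OF that(1), of i] unfolding that(2) by (metis fst_conv)
    then show ?thesis using that(1) fst_in[of i] by simp
  qed
  moreover have "infinite (range (\<lambda>i. snd (dec i)))"
  proof -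
    have "k \<in> range (\<lambda>i. snd (dec i))" for k
      by (rule image_eqI[of _ _ "enc (\<one>, k)"]) (simp_all add: dec_enc Y_def)
    then have "range (\<lambda>i. snd (dec i)) = UNIV" by blast
    then show ?thesis by simp
  qed
  ultimately show ?thesis
    unfolding regular_like_def
    using dec_\<Lambda> by (intro exI[of _ \<Lambda>] conjI exI[of _ "\<lambda>i. snd (dec i)"]) simp_all
qed

text \<open>No nontrivial power of \<open>g\<close> is the identity, so by freeness none has a fixed
  point; the orbit label of \<open>Q\<close> is constant on the cycles of \<open>g\<close>.\<close>

lemma regular_like_multishift:
  assumes "group Q" "regular_like Q \<Lambda>" "g \<in> carrier Q" "\<And>k::nat. k > 0 \<Longrightarrow> g [^]\<^bsub>Q\<^esub> k \<noteq> \<one>\<^bsub>Q\<^esub>"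
  shows "multishift (\<Lambda> g)"
proof -
  interpret Q: group Q by fact
  interpret \<Lambda>: group_hom Q perm_group \<Lambda>
    using assms group_perm_group by (auto simp: group_hom_def group_hom_axioms_def regular_like_def)
  have "\<Lambda> g ^^ k = \<Lambda> (g [^]\<^bsub>Q\<^esub> k)" for k :: nat
    using \<Lambda>.hom_nat_pow[OF assms(3), of k] by (simp add: pow_perm_group)
  then show ?thesis
    using assms \<Lambda>.hom_closed[OF assms(3)] unfolding multishift_def regular_like_def
    by auto
qed

lemma countable_free_group:
  assumes "countable S"
  shows "countable (carrier (free_group S))"
proof (rule countable_subset)
  show "carrier (free_group S) \<subseteq> words S" by (auto simp: carrier_free_group)
  show "countable (words S)" using assms by (intro countable_lists countable_SIGMA) auto
qed

section \<open>Amenable coset actions\<close>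

text \<open>Transport along \<open>\<beta>\<close>: an action on a convenient set, such as a set of
  cosets, described by plain equations, is carried over to \<open>\<Omega>\<close>.\<close>

lemma ex_transitive_faithful_amenable:
  assumes "group K" and \<beta>: "bij_betw \<beta> Y \<Omega>"
    and closed: "\<And>g x. g \<in> carrier K \<Longrightarrow> x \<in> Y \<Longrightarrow> \<alpha> g x \<in> Y"
    and one: "\<And>x. x \<in> Y \<Longrightarrow> \<alpha> \<one>\<^bsub>K\<^esub> x = x"
    and mult: "\<And>g h x. g \<in> carrier K \<Longrightarrow> h \<in> carrier K \<Longrightarrow> x \<in> Y \<Longrightarrow> \<alpha> (g \<otimes>\<^bsub>K\<^esub> h) x = \<alpha> g (\<alpha> h x)"
    and transitive: "\<And>x y. x \<in> Y \<Longrightarrow> y \<in> Y \<Longrightarrow> \<exists>g\<in>carrier K. \<alpha> g x = y"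
    and faithful: "\<And>g. g \<in> carrier K \<Longrightarrow> (\<And>x. x \<in> Y \<Longrightarrow> \<alpha> g x = x) \<Longrightarrow> g = \<one>\<^bsub>K\<^esub>"
    and A: "\<And>k::nat. finite (A k)" "\<And>k. A k \<noteq> {}" "\<And>k. A k \<subseteq> Y"
    and folner: "\<And>g. g \<in> carrier K \<Longrightarrow>
      (\<lambda>k. real (card ((A k - \<alpha> g ` A k) \<union> (\<alpha> g ` A k - A k))) / real (card (A k))) \<longlonglongrightarrow> 0"
  shows "\<exists>\<psi>. transitive_faithful_amenable K \<Omega> \<psi>"
proof -
  interpret group K by fact
  define \<gamma> where "\<gamma> = inv_into Y \<beta>"
  have \<gamma>: "bij_betw \<gamma> \<Omega> Y" unfolding \<gamma>_def by (rule bij_betw_inv_into[OF \<beta>])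
  have \<beta>_in: "x \<in> Y \<Longrightarrow> \<beta> x \<in> \<Omega>" for x using \<beta> by (auto simp: bij_betw_def)
  have \<gamma>_in: "w \<in> \<Omega> \<Longrightarrow> \<gamma> w \<in> Y" for w using \<gamma> by (auto simp: bij_betw_def)
  have \<gamma>\<beta>: "x \<in> Y \<Longrightarrow> \<gamma> (\<beta> x) = x" for x using \<beta> by (simp add: \<gamma>_def bij_betw_inv_into_left)
  have \<beta>\<gamma>: "w \<in> \<Omega> \<Longrightarrow> \<beta> (\<gamma> w) = w" for w using \<beta> by (simp add: \<gamma>_def bij_betw_inv_into_right)
  \<comment> \<open>The elements of \<open>BijGroup \<Omega>\<close> are extensional functions,
    hence the restriction to \<open>\<Omega>\<close>.\<close>
  define \<psi> where "\<psi> g = (\<lambda>w\<in>\<Omega>. \<beta> (\<alpha> g (\<gamma> w)))" for g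
  have \<psi>_in: "g \<in> carrier K \<Longrightarrow> w \<in> \<Omega> \<Longrightarrow> \<psi> g w \<in> \<Omega>" for g w
    by (simp add: \<psi>_def \<beta>_in \<gamma>_in closed)
  have \<psi>_mult: "\<psi> (g \<otimes>\<^bsub>K\<^esub> h) w = \<psi> g (\<psi> h w)" if "g \<in> carrier K" "h \<in> carrier K" "w \<in> \<Omega>" for g h w
    using that by (simp add: \<psi>_def \<beta>_in \<gamma>_in closed mult \<gamma>\<beta>)
  have \<psi>_one: "w \<in> \<Omega> \<Longrightarrow> \<psi> \<one>\<^bsub>K\<^esub> w = w" for w
    by (simp add: \<psi>_def one \<gamma>_in \<beta>\<gamma>)
  have \<psi>_Bij: "\<psi> g \<in> Bij \<Omega>" if g: "g \<in> carrier K" for g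
  proof -
    have "bij_betw (\<psi> g) \<Omega> \<Omega>"
    proof (rule bij_betwI[of _ _ _ "\<psi> (inv\<^bsub>K\<^esub> g)"])
      show "\<psi> (inv\<^bsub>K\<^esub> g) (\<psi> g w) = w" "\<psi> g (\<psi> (inv\<^bsub>K\<^esub> g) w) = w" if "w \<in> \<Omega>" for w
        using g that by (simp_all add: \<psi>_one flip: \<psi>_mult)
    qed (use g in \<open>auto simp: \<psi>_in\<close>)
    then show ?thesis by (simp add: Bij_def \<psi>_def)
  qed
  have "\<psi> \<in> hom K (BijGroup \<Omega>)"
  proof (rule homI)
    fix g h assume gh: "g \<in> carrier K" "h \<in> carrier K"
    have "\<psi> (g \<otimes>\<^bsub>K\<^esub> h) = compose \<Omega> (\<psi> g) (\<psi> h)"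
    proof
      fix w show "\<psi> (g \<otimes>\<^bsub>K\<^esub> h) w = compose \<Omega> (\<psi> g) (\<psi> h) w"
        using gh \<psi>_mult[of g h w] by (cases "w \<in> \<Omega>") (auto simp: compose_def \<psi>_def)
    qed
    then show "\<psi> (g \<otimes>\<^bsub>K\<^esub> h) = \<psi> g \<otimes>\<^bsub>BijGroup \<Omega>\<^esub> \<psi> h"
      using gh by (simp add: BijGroup_def \<psi>_Bij)
  qed (simp add: BijGroup_def \<psi>_Bij)
  then have action: "group_action K \<Omega> \<psi>"
    by (simp add: group_action_def group_hom_def group_hom_axioms_def group_BijGroup is_group)
  have "transitive_action K \<Omega> \<psi>"
  proof (intro transitive_action.intro action transitive_action_axioms.intro)
    fix v w assume "v \<in> \<Omega>" "w \<in> \<Omega>"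
    then obtain g where "g \<in> carrier K" "\<alpha> g (\<gamma> v) = \<gamma> w"
      using transitive \<gamma>_in by blast
    then show "\<exists>g\<in>carrier K. \<psi> g v = w"
      using \<open>v \<in> \<Omega>\<close> \<open>w \<in> \<Omega>\<close> by (intro bexI[of _ g]) (simp_all add: \<psi>_def \<beta>\<gamma>)
  qed
  moreover have "faithful_action K \<Omega> \<psi>"
  proof (intro faithful_action.intro action faithful_action_axioms.intro inj_onI)
    fix g h assume gh: "g \<in> carrier K" "h \<in> carrier K" "\<psi> g = \<psi> h"
    \<comment> \<open>Faithfulness is injectivity of \<open>\<psi>\<close>: if \<open>g\<close> and
      \<open>h\<close> act alike, their quotient fixes every point.\<close>
    have "inv\<^bsub>K\<^esub> g \<otimes>\<^bsub>K\<^esub> h = \<one>\<^bsub>K\<^esub>"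
    proof (rule faithful)
      fix x assume x: "x \<in> Y"
      have "\<psi> (inv\<^bsub>K\<^esub> g \<otimes>\<^bsub>K\<^esub> h) (\<beta> x) = \<psi> (inv\<^bsub>K\<^esub> g) (\<psi> g (\<beta> x))"
        using gh x by (simp add: \<psi>_mult \<beta>_in)
      also have "\<dots> = \<psi> (inv\<^bsub>K\<^esub> g \<otimes>\<^bsub>K\<^esub> g) (\<beta> x)"
        using gh(1) x \<beta>_in by (intro \<psi>_mult[symmetric]) simp_all
      also have "\<dots> = \<beta> x" using gh x by (simp add: \<psi>_one \<beta>_in)
      finally have "\<beta> (\<alpha> (inv\<^bsub>K\<^esub> g \<otimes>\<^bsub>K\<^esub> h) x) = \<beta> x" using x by (simp add: \<psi>_def \<beta>_in \<gamma>\<beta>)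
      then show "\<alpha> (inv\<^bsub>K\<^esub> g \<otimes>\<^bsub>K\<^esub> h) x = x"
        using gh x by (metis \<gamma>\<beta> closed inv_closed m_closed)
    qed (use gh in simp)
    then show "g = h" using gh by (metis inv_equality inv_inv inv_closed)
  qed
  moreover have "amenable_action K \<Omega> \<psi>"
    unfolding amenable_action_def
  proof (intro exI[of _ "\<lambda>k. \<beta> ` A k"] conjI allI ballI)
    fix g assume g: "g \<in> carrier K"
    have "card ((\<beta> ` A k - \<psi> g ` \<beta> ` A k) \<union> (\<psi> g ` \<beta> ` A k - \<beta> ` A k)) =
          card ((A k - \<alpha> g ` A k) \<union> (\<alpha> g ` A k - A k))" and "card (\<beta> ` A k) = card (A k)" for k
    proof -
      have inj: "inj_on \<beta> Y" using \<beta> by (simp add: bij_betw_def)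
      have sub: "A k \<subseteq> Y" "\<alpha> g ` A k \<subseteq> Y" using A(3) closed[OF g] by auto
      have "\<psi> g ` \<beta> ` A k = \<beta> ` \<alpha> g ` A k"
        unfolding image_image using A(3)[of k] by (intro image_cong) (auto simp: \<psi>_def \<beta>_in \<gamma>\<beta>)
      then have "(\<beta> ` A k - \<psi> g ` \<beta> ` A k) \<union> (\<psi> g ` \<beta> ` A k - \<beta> ` A k) =
          \<beta> ` ((A k - \<alpha> g ` A k) \<union> (\<alpha> g ` A k - A k))"
        using inj_on_image_set_diff[OF inj, of "A k" "\<alpha> g ` A k"]
          inj_on_image_set_diff[OF inj, of "\<alpha> g ` A k" "A k"] sub
        by (simp add: image_Un Diff_subset[THEN subset_trans])
      then show "card ((\<beta> ` A k - \<psi> g ` \<beta> ` A k) \<union> (\<psi> g ` \<beta> ` A k - \<beta> ` A k)) =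
          card ((A k - \<alpha> g ` A k) \<union> (\<alpha> g ` A k - A k))"
        using inj sub by (metis (no_types, lifting) card_image Diff_subset Un_least inj_on_subset order_trans)
      show "card (\<beta> ` A k) = card (A k)" using inj sub by (meson card_image inj_on_subset)
    qed
    then show "(\<lambda>k. real (card ((\<beta> ` A k - \<psi> g ` \<beta> ` A k) \<union> (\<psi> g ` \<beta> ` A k - \<beta> ` A k))) / real (card (\<beta> ` A k))) \<longlonglongrightarrow> 0"
      using folner[OF g] by simp
  next
    show "\<beta> ` A k \<subseteq> \<Omega>" for k using A(3)[of k] \<beta>_in by auto
  qed (simp_all add: A)
  ultimately show ?thesis unfolding transitive_faithful_amenable_def by blast
qed

text \<open>Pigeonhole: two of the cosets of \<open>H\<close> through natural powers of
  \<open>a\<close> coincide, and the difference of their exponents serves as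
  \<open>s\<close>.\<close>

lemma (in group) finite_index_int_pow:
  assumes "subgroup H G" "finite (rcosets H)" "a \<in> carrier G"
  obtains s :: int where "s > 0" "a [^] s \<in> H"
proof -
  have "finite (range (\<lambda>i::nat. H #> a [^] i))"
    using assms(2,3) by (rule_tac finite_subset[OF _ assms(2)]) (auto simp: RCOSETS_def)
  then have "\<not> inj (\<lambda>i::nat. H #> a [^] i)"
    using finite_imageD infinite_UNIV_nat by blast
  then obtain i j :: nat where ij: "i < j" "H #> a [^] i = H #> a [^] j"
    unfolding inj_def by (metis linorder_neqE_nat)
  have "a [^] j \<in> H #> a [^] i"
    using ij assms rcos_self[of "a [^] j" H] by simp
  then obtain h where h: "h \<in> H" "a [^] j = h \<otimes> a [^] i" by (auto simp: r_coset_def)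
  then have "h = a [^] j \<otimes> inv (a [^] i)"
    using assms subgroup.mem_carrier[OF assms(1)] by (simp add: m_assoc)
  also have "\<dots> = a [^] (int j - int i)"
    using assms by (simp add: int_pow_diff int_pow_int)
  finally show ?thesis using that[of "int j - int i"] h ij by simp
qed

text \<open>The points \<open>a\<^sup>-\<^sup>j B\<close> for large \<open>j\<close> are permuted by any fixed element \<open>g\<close> as integers are by the
  translation by \<open>e g\<close>, so that long intervals of such points are Folner sets.\<close>

theorem (in group) coset_action_amenable:
  fixes e :: "'a \<Rightarrow> int"
  assumes "countable (carrier G)" and B: "subgroup B G" and a: "a \<in> carrier G"
    and e_mult: "\<And>g h. g \<in> carrier G \<Longrightarrow> h \<in> carrier G \<Longrightarrow> e (g \<otimes> h) = e g + e h"
    and e_a: "e a = 1" and e_B: "\<And>b. b \<in> B \<Longrightarrow> e b = 0"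
    and absorb: "\<And>g. g \<in> carrier G \<Longrightarrow> \<exists>k0::int. \<forall>k\<ge>k0. a [^] k \<otimes> g \<otimes> a [^] - (k + e g) \<in> B"
    and core: "\<And>g. g \<in> carrier G \<Longrightarrow> g \<noteq> \<one> \<Longrightarrow> \<exists>k0::int. \<forall>k\<ge>k0. a [^] (- k) \<otimes> g \<otimes> a [^] k \<notin> B"
    and H: "subgroup H G" "finite (rcosets H)"
    and \<Omega>: "infinite \<Omega>" "countable \<Omega>"
  shows "\<exists>\<psi>. transitive_faithful_amenable (G\<lparr>carrier := H\<rparr>) \<Omega> \<psi>"
proof -
  have HG: "h \<in> carrier G" if "h \<in> H" for h using that H(1) by (simp add: subgroup.mem_carrier)
  have BG: "B \<subseteq> carrier G" using B by (simp add: subgroup.subset)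
  have lcos: "g <# (h <# B) = (g \<otimes> h) <# B" if "g \<in> carrier G" "h \<in> carrier G" for g h
    using that BG by (simp add: lcos_m_assoc)
  have lcos_eq: "g <# B = h <# B \<longleftrightarrow> inv g \<otimes> h \<in> B" if gh: "g \<in> carrier G" "h \<in> carrier G" for g h
  proof
    assume eq: "g <# B = h <# B"
    have "h \<otimes> \<one> \<in> h <# B" using subgroup.one_closed[OF B] by (auto simp: l_coset_def)
    then obtain b where "b \<in> B" "h = g \<otimes> b"
      using gh(2) unfolding eq[symmetric] by (auto simp: l_coset_def)
    moreover have "inv g \<otimes> (g \<otimes> b) = b"
      using gh(1) BG \<open>b \<in> B\<close> by (auto intro: inv_mult_cancel)
    ultimately show "inv g \<otimes> h \<in> B" by simp
  next
    assume b: "inv g \<otimes> h \<in> B"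
    have "g \<otimes> (inv g \<otimes> h) = h"
      using gh by (rule inv_mult_cancel)
    then have "h <# B = g <# ((inv g \<otimes> h) <# B)"
      using gh by (simp add: lcos)
    also have "(inv g \<otimes> h) <# B = B"
      using b BG by (intro coset_join3 B) auto
    finally show "g <# B = h <# B" ..
  qed
  have e_one: "e \<one> = 0" using e_mult[of \<one> \<one>] by simp
  have e_inv: "e (inv g) = - e g" if "g \<in> carrier G" for g
    using that e_mult[of "inv g" g] e_one by simp
  have e_nat_pow: "e (a [^] k) = int k" for k :: nat
  proof (induction k)
    case (Suc k)
    then show ?case using a e_mult[of "a [^] k" a] by (simp add: e_a)
  qed (simp add: e_one)
  have e_pow: "e (a [^] z) = z" for z :: int
    using a by (cases z rule: int_cases2)
      (simp_all add: int_pow_int int_pow_neg_int e_nat_pow e_inv)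
  \<comment> \<open>This power keeps infinitely many of the points below inside one orbit of
    \<open>H\<close>, even if \<open>a\<close> itself is not in \<open>H\<close>.\<close>
  obtain s :: int where s: "s > 0" "a [^] s \<in> H"
    using finite_index_int_pow[OF H a] by blast
  have s_H: "a [^] (s * i) \<in> H" for i :: int
    using s(2) a H(1) by (metis int_pow_pow subgroup_int_pow_closed)

  \<comment> \<open>Only the orbit of the coset \<open>B\<close> under \<open>H\<close>, so that
    \<open>H\<close> acts transitively.\<close>
  define Y where "Y = {h <# B | h. h \<in> H}"
  have Y_closed: "h <# x \<in> Y" if "h \<in> H" "x \<in> Y" for h x
    using that H(1) by (auto simp: Y_def lcos HG intro: subgroup.m_closed)
  have Y_assoc: "(g \<otimes> h) <# x = g <# (h <# x)" if "g \<in> carrier G" "h \<in> carrier G" "x \<in> Y" for g h x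
    using that by (auto simp: Y_def lcos HG m_assoc)
  have Y_one: "\<one> <# x = x" if "x \<in> Y" for x
    using that by (auto simp: Y_def lcos HG)
  define p where "p z = a [^] (- z) <# B" for z :: int
  \<comment> \<open>Distinct powers of \<open>a\<close> have distinct degrees, while all of
    \<open>B\<close> has degree zero.\<close>
  have p_inj: "i = j" if "p i = p j" for i j
  proof -
    have "inv (a [^] (- i)) \<otimes> a [^] (- j) \<in> B"
      using that a by (simp add: p_def lcos_eq)
    from e_B[OF this] show ?thesis
      using a by (simp add: e_mult e_inv e_pow)
  qed
  have p_Y: "p (s * i) \<in> Y" for i
    using s_H[of "- i"] by (auto simp: Y_def p_def)
  \<comment> \<open>For \<open>k = j - e h\<close> the last exponent in \<open>absorb\<close> is
    \<open>- j\<close>, so membership in \<open>B\<close> says that \<open>h\<close> takes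
    \<open>p j\<close> to \<open>p (j - e h)\<close>.\<close>
  have shift: "\<exists>k0. \<forall>j\<ge>k0. h <# p j = p (j - e h)" if h: "h \<in> carrier G" for h
  proof -
    obtain k0 where k0: "\<And>k. k \<ge> k0 \<Longrightarrow> a [^] k \<otimes> h \<otimes> a [^] - (k + e h) \<in> B"
      using absorb[OF h] by blast
    have "h <# p j = p (j - e h)" if "j \<ge> k0 + e h" for j
    proof -
      have "inv (a [^] (- (j - e h))) \<otimes> (h \<otimes> a [^] (- j)) \<in> B"
        using k0[of "j - e h"] that h a by (simp add: int_pow_neg m_assoc flip: int_pow_neg)
      then show ?thesis using a h by (simp add: p_def lcos lcos_eq[symmetric])
    qed
    then show ?thesis by blast
  qed
  \<comment> \<open>Some \<open>p j\<close> may lie outside the orbit. At large indices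
    \<open>J\<close> is invariant under translation by \<open>e h\<close> for \<open>h\<close> in
    \<open>H\<close>.\<close>
  define J where "J = {j. p j \<in> Y}"
  \<comment> \<open>The window from \<open>M k\<close> to \<open>2 * M k\<close> moves to infinity,
    where elements act as translations, and it grows: it contains at least \<open>k + 1\<close>
    multiples of \<open>s\<close>.\<close>
  define M where "M k = s * (1 + int k)" for k
  define A where "A k = p ` (J \<inter> {M k..<2 * M k})" for k
  have A_finite: "finite (A k)" for k by (simp add: A_def)
  have A_card: "card (A k) \<ge> Suc k" for k
  proof -
    have "inj_on (\<lambda>i. p (s * (1 + int k + int i))) {..k}"
      using s(1) by (auto simp: inj_on_def dest!: p_inj)
    moreover have "(\<lambda>i. p (s * (1 + int k + int i))) ` {..k} \<subseteq> A k"
    proof -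
      have "M k \<le> s * (1 + int k + int i)" "s * (1 + int k + int i) < 2 * M k" if "i \<le> k" for i
      proof -
        show "M k \<le> s * (1 + int k + int i)" using s(1) by (simp add: M_def)
        have "s * (1 + int k + int i) < s * (2 * (1 + int k))" using s(1) that by simp
        then show "s * (1 + int k + int i) < 2 * M k" by (simp only: M_def mult.left_commute)
      qed
      then show ?thesis by (auto simp: A_def J_def p_Y)
    qed
    ultimately have "card {..k} \<le> card (A k)"
      using A_finite by (metis card_image card_mono)
    then show ?thesis by simp
  qed
  have A_nonempty: "A k \<noteq> {}" for k using A_card[of k] by auto
  have A_sub: "A k \<subseteq> Y" for k by (auto simp: A_def J_def)
  have folner: "(\<lambda>k. real (card ((A k - l_coset G h ` A k) \<union> (l_coset G h ` A k - A k))) / real (card (A k))) \<longlonglongrightarrow> 0"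
    if h: "h \<in> H" for h
  proof -
    obtain k0 where k0: "\<And>j. j \<ge> k0 \<Longrightarrow> h <# p j = p (j - e h)"
      using shift[OF HG[OF h]] by blast
    have J_shift: "j - e h \<in> J \<longleftrightarrow> j \<in> J" if "j \<ge> k0" for j
    proof
      assume "j \<in> J"
      then show "j - e h \<in> J" using k0[OF that] Y_closed[OF h] by (metis J_def mem_Collect_eq)
    next
      assume "j - e h \<in> J"
      then have "inv h <# (h <# p j) \<in> Y"
        using k0[OF that] h H(1) by (metis J_def Y_closed mem_Collect_eq subgroup.m_inv_closed)
      also have "inv h <# (h <# p j) = p j"
        using HG[OF h] a by (simp add: p_def lcos flip: m_assoc)
      finally show "j \<in> J" by (simp add: J_def)
    qed
    \<comment> \<open>A translation by \<open>e h\<close> affects membership in the window only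
      within distance \<open>\<bar>e h\<bar>\<close> of its two ends, a number of indices bounded
      independently of \<open>k\<close>.\<close>
    define D where "D k = {M k - \<bar>e h\<bar>..<M k + \<bar>e h\<bar>} \<union> {2 * M k - \<bar>e h\<bar>..<2 * M k + \<bar>e h\<bar>}" for k
    have D_card: "card (D k) \<le> nat (4 * \<bar>e h\<bar>)" for k
      unfolding D_def by (rule order_trans[OF card_Un_le]) simp
    have sub: "(A k - l_coset G h ` A k) \<union> (l_coset G h ` A k - A k) \<subseteq> p ` D k" if k: "M k \<ge> k0 + \<bar>e h\<bar>" for k
    proof
      fix x assume "x \<in> (A k - l_coset G h ` A k) \<union> (l_coset G h ` A k - A k)"
      then consider "x \<in> A k" "x \<notin> l_coset G h ` A k" | "x \<in> l_coset G h ` A k" "x \<notin> A k" by blast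
      then show "x \<in> p ` D k"
      proof cases
        case 1
        then obtain j where j: "x = p j" "j \<in> J" "M k \<le> j" "j < 2 * M k" by (auto simp: A_def)
        have "h <# p (j + e h) = x" using j k k0[of "j + e h"] by simp
        moreover have "j + e h \<in> J" using J_shift[of "j + e h"] j k by simp
        ultimately have "\<not> (M k \<le> j + e h \<and> j + e h < 2 * M k)"
          using 1(2) by (force simp: A_def)
        then have "j \<in> D k" using j by (auto simp: D_def)
        then show ?thesis using j by blast
      next
        case 2
        then obtain j where j: "x = h <# p j" "j \<in> J" "M k \<le> j" "j < 2 * M k" by (auto simp: A_def)
        have x: "x = p (j - e h)" using j k k0[of j] by simp
        moreover have "j - e h \<in> J" using J_shift[of j] j k by simp
        ultimately have "\<not> (M k \<le> j - e h \<and> j - e h < 2 * M k)"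
          using 2(2) by (force simp: A_def)
        then have "j - e h \<in> D k" using j by (auto simp: D_def)
        then show ?thesis using x by blast
      qed
    qed
    have bound: "real (card ((A k - l_coset G h ` A k) \<union> (l_coset G h ` A k - A k))) / real (card (A k))
        \<le> real_of_int (4 * \<bar>e h\<bar>) / real (Suc k)" if k: "M k \<ge> k0 + \<bar>e h\<bar>" for k
    proof (rule frac_le)
      have "card ((A k - l_coset G h ` A k) \<union> (l_coset G h ` A k - A k)) \<le> card (p ` D k)"
        using sub[OF k] by (rule card_mono[rotated]) (simp add: D_def)
      also have "\<dots> \<le> card (D k)" by (rule card_image_le) (simp add: D_def)
      finally show "real (card ((A k - l_coset G h ` A k) \<union> (l_coset G h ` A k - A k))) \<le> real_of_int (4 * \<bar>e h\<bar>)"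
        using D_card[of k] by linarith
      show "real (Suc k) \<le> real (card (A k))" using A_card by (rule of_nat_mono)
    qed simp_all
    have "eventually (\<lambda>k. M k \<ge> k0 + \<bar>e h\<bar>) sequentially"
      unfolding eventually_sequentially
    proof (intro exI allI impI)
      fix k assume "nat (k0 + \<bar>e h\<bar>) \<le> k"
      moreover have "1 + int k \<le> M k" using s(1) by (simp add: M_def)
      ultimately show "k0 + \<bar>e h\<bar> \<le> M k" by linarith
    qed
    then have upper: "\<forall>\<^sub>F k in sequentially.
        real (card ((A k - l_coset G h ` A k) \<union> (l_coset G h ` A k - A k))) / real (card (A k))
        \<le> real_of_int (4 * \<bar>e h\<bar>) / real (Suc k)"
      by (rule eventually_mono) (rule bound)
    have lower: "\<forall>\<^sub>F k in sequentially.
        0 \<le> real (card ((A k - l_coset G h ` A k) \<union> (l_coset G h ` A k - A k))) / real (card (A k))"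
      by (intro always_eventually allI divide_nonneg_nonneg of_nat_0_le_iff)
    have limit: "(\<lambda>k. real_of_int (4 * \<bar>e h\<bar>) / real (Suc k)) \<longlonglongrightarrow> 0"
      by (rule LIMSEQ_Suc[OF lim_const_over_n])
    show ?thesis
      by (rule tendsto_sandwich[OF lower upper tendsto_const limit])
  qed

  have "infinite Y"
  proof
    assume "finite Y"
    moreover have "range (\<lambda>i. p (s * i)) \<subseteq> Y" using p_Y by blast
    moreover have "inj (\<lambda>i. p (s * i))" using s(1) by (auto simp: inj_def dest!: p_inj)
    ultimately show False by (meson finite_imageD finite_subset infinite_UNIV_int)
  qed
  moreover have "countable Y"
  proof -
    have "Y = (\<lambda>h. h <# B) ` H" by (auto simp: Y_def)
    moreover have "countable H" using assms(1) HG by (meson countable_subset subsetI)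
    ultimately show ?thesis by simp
  qed
  ultimately obtain \<beta> where \<beta>: "bij_betw \<beta> Y \<Omega>"
    using \<Omega> by (metis bij_betw_from_nat_into bij_betw_trans to_nat_on_infinite)
  show ?thesis
  proof (rule ex_transitive_faithful_amenable[OF _ \<beta>, of _ "l_coset G" A])
    show "group (G\<lparr>carrier := H\<rparr>)" using H(1) subgroup.subgroup_is_group is_group by blast
    show "\<exists>g\<in>carrier (G\<lparr>carrier := H\<rparr>). g <# x = y" if xy: "x \<in> Y" "y \<in> Y" for x y
    proof -
      obtain g h where gh: "g \<in> H" "h \<in> H" "x = g <# B" "y = h <# B"
        using xy unfolding Y_def by blast
      then have "(h \<otimes> inv g) <# x = y" by (simp add: lcos HG m_assoc)
      moreover have "h \<otimes> inv g \<in> H" using gh H(1) by (simp add: subgroup.m_closed subgroup.m_inv_closed)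
      ultimately show ?thesis by auto
    qed
    show "g = \<one>\<^bsub>G\<lparr>carrier := H\<rparr>\<^esub>" if g: "g \<in> carrier (G\<lparr>carrier := H\<rparr>)"
      and fix_all: "\<And>x. x \<in> Y \<Longrightarrow> g <# x = x" for g
    proof (rule ccontr)
      assume "g \<noteq> \<one>\<^bsub>G\<lparr>carrier := H\<rparr>\<^esub>"
      then have "\<exists>k0::int. \<forall>k\<ge>k0. a [^] (- k) \<otimes> g \<otimes> a [^] k \<notin> B"
        using g HG by (intro core) simp_all
      then obtain k0 :: int where k0: "\<forall>k\<ge>k0. a [^] (- k) \<otimes> g \<otimes> a [^] k \<notin> B" ..
      \<comment> \<open>An exponent beyond \<open>k0\<close> that is a multiple of \<open>s\<close>,
        so that the coset of \<open>a [^] k\<close> lies in the orbit.\<close>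
      define k where "k = s * \<bar>k0\<bar>"
      have "1 * \<bar>k0\<bar> \<le> k" unfolding k_def using s(1) by (intro mult_right_mono) simp_all
      then have "k0 \<le> k" by simp
      have "a [^] k <# B \<in> Y" using s_H[of "\<bar>k0\<bar>"] unfolding Y_def k_def by blast
      then have "g <# (a [^] k <# B) = a [^] k <# B" by (rule fix_all)
      moreover have gG: "g \<in> carrier G" using g HG by simp
      ultimately have "inv (a [^] k) \<otimes> (g \<otimes> a [^] k) \<in> B"
        using a lcos_eq[of "a [^] k" "g \<otimes> a [^] k"] lcos[of g "a [^] k"] by simp
      then have "a [^] (- k) \<otimes> g \<otimes> a [^] k \<in> B"
        using gG a by (simp add: int_pow_neg m_assoc)
      moreover have "a [^] (- k) \<otimes> g \<otimes> a [^] k \<notin> B" using k0 \<open>k0 \<le> k\<close> by simp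
      ultimately show False by simp
    qed
    show "(\<lambda>k. real (card ((A k - l_coset G g ` A k) \<union> (l_coset G g ` A k - A k))) / real (card (A k))) \<longlonglongrightarrow> 0"
      if "g \<in> carrier (G\<lparr>carrier := H\<rparr>)" for g
      using that by (intro folner) simp
  qed (simp_all add: Y_closed Y_one Y_assoc HG A_finite A_nonempty A_sub)
qed

section \<open>The amalgam\<close>

lemma (in group) normal_normal_closure:
  assumes "R \<subseteq> carrier G"
  shows "normal_closure G R \<lhd> G"
  unfolding normal_closure_def
proof (rule normal_generateI)
  show "{g \<otimes> r \<otimes> inv g | g r. g \<in> carrier G \<and> r \<in> R} \<subseteq> carrier G"
    using assms by auto
  fix h x assume "h \<in> {g \<otimes> r \<otimes> inv g | g r. g \<in> carrier G \<and> r \<in> R}" and x: "x \<in> carrier G"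
  then obtain g r where g: "h = g \<otimes> r \<otimes> inv g" "g \<in> carrier G" "r \<in> R" by blast
  then have "x \<otimes> h \<otimes> inv x = (x \<otimes> g) \<otimes> r \<otimes> inv (x \<otimes> g)"
    using x assms by (simp add: m_assoc inv_mult_group subset_iff)
  then show "x \<otimes> h \<otimes> inv x \<in> {g \<otimes> r \<otimes> inv g | g r. g \<in> carrier G \<and> r \<in> R}"
    using g x by blast
qed

lemma (in group) normal_closure_incl:
  assumes "r \<in> R" "R \<subseteq> carrier G"
  shows "r \<in> normal_closure G R"
  unfolding normal_closure_def
proof (rule generate.incl)
  have "r = \<one> \<otimes> r \<otimes> inv \<one>" using assms by auto
  then show "r \<in> {g \<otimes> r \<otimes> inv g | g r. g \<in> carrier G \<and> r \<in> R}"
    using assms(1) one_closed by blast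
qed

lemma (in group_hom) hom_normal_closure:
  assumes "R \<subseteq> carrier G" "\<And>r. r \<in> R \<Longrightarrow> h r = \<one>\<^bsub>H\<^esub>" "g \<in> normal_closure G R"
  shows "h g = \<one>\<^bsub>H\<^esub>"
proof -
  have "subgroup (kernel G H h) G" by (rule subgroup_kernel)
  moreover have "{g \<otimes> r \<otimes> inv g | g r. g \<in> carrier G \<and> r \<in> R} \<subseteq> kernel G H h"
    using assms(1,2) by (auto simp: kernel_def subset_iff)
  ultimately have "normal_closure G R \<subseteq> kernel G H h"
    unfolding normal_closure_def by (rule G.generate_subgroup_incl[rotated])
  then show ?thesis using assms(3) by (auto simp: kernel_def)
qed

lemma exp_sum_Nil [simp]: "exp_sum s [] = 0"
  by (simp add: exp_sum_def)

lemma exp_sum_Cons: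
  "exp_sum s (x # w) = (if fst x = s then (if snd x then -1 else 1) else 0) + exp_sum s w"
  by (simp add: exp_sum_def)

lemma abs_exp_sum_le: "\<bar>exp_sum s w\<bar> \<le> int (length w)"
  by (induction w) (auto simp: exp_sum_Cons)

text \<open>With exponent sums seen as evaluations in \<int>, the degree on the amalgam can be
  obtained from its universal property.\<close>

lemma eval_word_integer_group:
  "eval_word integer_group (\<lambda>t. if t = s then 1 else 0) w = exp_sum s w"
  by (induction w) (auto simp: eval_word_Cons exp_sum_Cons)

lemma eval_inl_word: "eval_word G f (inl_word w) = eval_word G (\<lambda>j. f (Inl j)) w"
  unfolding inl_word_def by (rule eval_word_map)

lemma eval_inr_word: "eval_word G f (inr_word w) = eval_word G (\<lambda>j. f (Inr j)) w"
  unfolding inr_word_def by (rule eval_word_map)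

locale amalgam =
  fixes n m :: nat and c d :: "(nat \<times> bool) list"
  assumes c: "c \<in> carrier (free_group {..n})" "c \<noteq> []"
    and d: "d \<in> carrier (free_group {..m})" "d \<noteq> []"
begin

abbreviation S :: "(nat + nat) set" where "S \<equiv> Inl ` {..n} \<union> Inr ` {..m}"
abbreviation F where "F \<equiv> free_group S"
abbreviation N where "N \<equiv> normal_closure F {inl_word c \<otimes>\<^bsub>F\<^esub> inv\<^bsub>F\<^esub> (inr_word d)}"
abbreviation Q where "Q \<equiv> amalgam_free n m c d"

definition \<iota> :: "nat + nat \<Rightarrow> ((nat + nat) \<times> bool) list set" where
  "\<iota> s = N #>\<^bsub>F\<^esub> [(s, False)]"

lemma c_words: "c \<in> words {..n}" and d_words: "d \<in> words {..m}"
  using c d by (simp_all add: carrier_free_group)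

lemma inl_c_words: "inl_word c \<in> words S" and inr_d_words: "inr_word d \<in> words S"
  using c_words d_words unfolding words_iff inl_word_def inr_word_def by auto

lemma reduced_inl_word: "reduced w \<Longrightarrow> reduced (inl_word w)"
  by (induction w rule: reduced.induct) (auto simp: inl_word_def inv_letter_def)

lemma reduced_inr_word: "reduced w \<Longrightarrow> reduced (inr_word w)"
  by (induction w rule: reduced.induct) (auto simp: inr_word_def inv_letter_def)

lemma inl_c_F: "inl_word c \<in> carrier F" and inr_d_F: "inr_word d \<in> carrier F"
  using c d inl_c_words inr_d_words reduced_inl_word reduced_inr_word
  by (auto simp: carrier_free_group)

lemma group_F: "group F"
  by (rule free_group_is_group)

lemma relator_F: "{inl_word c \<otimes>\<^bsub>F\<^esub> inv\<^bsub>F\<^esub> (inr_word d)} \<subseteq> carrier F"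
  using group.is_monoid[OF group_F] group.inv_closed[OF group_F inr_d_F] inl_c_F
  by (auto intro: monoid.m_closed simp del: mult_free_group)

lemma normal_N: "N \<lhd> F"
  using group.normal_normal_closure[OF group_F relator_F] .

lemma Q_def: "Q = F Mod N"
  by (simp add: amalgam_free_def)

lemma group_Q: "group Q"
  unfolding Q_def using normal_N by (rule normal.factorgroup_is_group)

lemma coset_hom: "(\<lambda>w. N #>\<^bsub>F\<^esub> w) \<in> hom F Q"
  unfolding Q_def by (rule normal.r_coset_hom_Mod[OF normal_N])

lemma \<iota>_carrier: "\<iota> \<in> S \<rightarrow> carrier Q"
  using hom_in_carrier[OF coset_hom] generators_in_free_group[of S] by (auto simp: \<iota>_def Pi_iff)

lemma eval_\<iota>: "w \<in> words S \<Longrightarrow> eval_word Q \<iota> w = N #>\<^bsub>F\<^esub> reduce w"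
  using hom_eval_word[OF group_F group_Q coset_hom _ generators_in_free_group, of w]
  by (simp add: eval_word_free_group \<iota>_def[abs_def])

lemma Q_cases:
  assumes "g \<in> carrier Q"
  obtains w where "w \<in> words S" "g = eval_word Q \<iota> w"
proof -
  obtain w where "w \<in> carrier F" "g = N #>\<^bsub>F\<^esub> w"
    using assms by (auto simp: Q_def carrier_FactGroup)
  then show ?thesis
    using that[of w] eval_\<iota>[of w] by (simp add: carrier_free_group reduce_reduced)
qed

lemma countable_Q: "countable (carrier Q)"
proof -
  have "countable (carrier F)" by (rule countable_free_group) simp
  then show ?thesis by (simp add: Q_def carrier_FactGroup)
qed

text \<open>The universal property of the amalgam: evaluation in \<open>H\<close> kills the relator,
  hence its normal closure, and so factors through the quotient.\<close>

lemma lift: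
  assumes "group H" "f \<in> S \<rightarrow> carrier H" "eval_word H f (inl_word c) = eval_word H f (inr_word d)"
  obtains \<tau> where "\<tau> \<in> hom Q H" "\<And>w. w \<in> words S \<Longrightarrow> \<tau> (eval_word Q \<iota> w) = eval_word H f w"
proof -
  interpret F: group F by (rule group_F)
  interpret H: group H by fact
  interpret h: group_hom F H "eval_word H f"
    using H.eval_word_hom[OF assms(2)] by (intro group_hom.intro group_hom_axioms.intro F.is_group assms(1))
  have "eval_word H f (inl_word c \<otimes>\<^bsub>F\<^esub> inv\<^bsub>F\<^esub> (inr_word d)) = \<one>\<^bsub>H\<^esub>"
    using inl_c_F inr_d_F assms(3) h.hom_closed[OF inr_d_F]
    by (simp add: h.hom_mult h.hom_inv del: mult_free_group)
  then have kill: "eval_word H f w = \<one>\<^bsub>H\<^esub>" if "w \<in> N" for w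
    using h.hom_normal_closure[OF relator_F _ that] by auto
  have "eval_word H f u = eval_word H f v"
    if "u \<in> carrier F" "v \<in> carrier F" "N #>\<^bsub>F\<^esub> u = N #>\<^bsub>F\<^esub> v" for u v
  proof -
    have "u \<in> N #>\<^bsub>F\<^esub> v"
      using F.rcos_self[of u N] that normal_imp_subgroup[OF normal_N] by simp
    then obtain w where w: "w \<in> N" "u = w \<otimes>\<^bsub>F\<^esub> v" by (auto simp: r_coset_def)
    have "w \<in> carrier F" using w(1) normal_imp_subgroup[OF normal_N] by (rule subgroup.mem_carrier[rotated])
    then show ?thesis
      using w that(2) kill h.hom_mult[of w v] h.hom_closed[of v] by simp
  qed
  from FactGroup_universal[OF h.homh normal_N this]
  obtain \<tau> where \<tau>: "\<tau> \<in> hom (F Mod N) H" "\<And>x. x \<in> carrier F \<Longrightarrow> \<tau> (N #>\<^bsub>F\<^esub> x) = eval_word H f x"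
    by metis
  have "\<tau> (eval_word Q \<iota> w) = eval_word H f w" if "w \<in> words S" for w
    using that \<tau>(2)[of "reduce w"] H.eval_word_reduce[OF that assms(2)]
    by (simp add: eval_\<iota> carrier_free_group reduce_in_words)
  with \<tau>(1) show ?thesis using that unfolding Q_def by blast
qed

lemma relation: "eval_word Q (\<lambda>j. \<iota> (Inl j)) c = eval_word Q (\<lambda>j. \<iota> (Inr j)) d"
proof -
  interpret F: group F by (rule group_F)
  interpret Q: group Q by (rule group_Q)
  interpret coset: group_hom F Q "\<lambda>w. N #>\<^bsub>F\<^esub> w"
    using coset_hom by (intro group_hom.intro group_hom_axioms.intro group_F group_Q)
  have "inl_word c \<otimes>\<^bsub>F\<^esub> inv\<^bsub>F\<^esub> (inr_word d) \<in> N"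
    by (rule F.normal_closure_incl[OF _ relator_F]) simp
  then have "N #>\<^bsub>F\<^esub> (inl_word c \<otimes>\<^bsub>F\<^esub> inv\<^bsub>F\<^esub> (inr_word d)) = \<one>\<^bsub>Q\<^esub>"
    using subgroup.rcos_const[OF normal_imp_subgroup[OF normal_N] group_F] by (simp add: Q_def del: mult_free_group)
  then have "(N #>\<^bsub>F\<^esub> inl_word c) \<otimes>\<^bsub>Q\<^esub> inv\<^bsub>Q\<^esub> (N #>\<^bsub>F\<^esub> inr_word d) = \<one>\<^bsub>Q\<^esub>"
    using inl_c_F inr_d_F by (simp add: coset.hom_mult coset.hom_inv del: mult_free_group)
  then have "N #>\<^bsub>F\<^esub> inl_word c = N #>\<^bsub>F\<^esub> inr_word d"
    using coset.hom_closed[OF inl_c_F] coset.hom_closed[OF inr_d_F]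
    by (metis Q.inv_closed Q.inv_equality Q.inv_inv)
  moreover have "reduce (inl_word c) = (inl_word c :: ((nat + nat) \<times> bool) list)"
    "reduce (inr_word d) = (inr_word d :: ((nat + nat) \<times> bool) list)"
    using inl_c_F inr_d_F by (simp_all add: carrier_free_group reduce_reduced)
  ultimately have "eval_word Q \<iota> (inl_word c) = eval_word Q \<iota> (inr_word d)"
    by (simp add: eval_\<iota> inl_c_words inr_d_words)
  then show ?thesis by (simp add: eval_inl_word eval_inr_word)
qed

end

section \<open>The left factor inside the amalgam\<close>

lemma (in amalgam) \<iota>_Inl_carrier: "(\<lambda>j. \<iota> (Inl j)) \<in> {..n} \<rightarrow> carrier Q"
  and \<iota>_Inr_carrier: "(\<lambda>j. \<iota> (Inr j)) \<in> {..m} \<rightarrow> carrier Q"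
  using \<iota>_carrier by auto

text \<open>Let both free factors act freely with infinitely many orbits. As \<open>c\<close> and
  \<open>d\<close> have infinite order, they act as multishifts, and conjugating the right action
  makes them agree. The resulting action of the amalgam is still free on the left factor.\<close>

lemma (in amalgam) left_factor_embeds:
  assumes "w \<in> carrier (free_group {..n})" "eval_word Q (\<lambda>j. \<iota> (Inl j)) w = \<one>\<^bsub>Q\<^esub>"
  shows "w = []"
proof -
  let ?F1 = "free_group {..n}" and ?F2 = "free_group {..m}"
  have g: "group ?F1" "group ?F2" by (rule free_group_is_group)+
  have "countable (carrier ?F1)" "countable (carrier ?F2)" by (simp_all add: countable_free_group)
  then obtain \<Lambda> \<Lambda>' where \<Lambda>: "regular_like ?F1 \<Lambda>" and \<Lambda>': "regular_like ?F2 \<Lambda>'"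
    using group.ex_regular_like g by blast
  have hom: "\<Lambda> \<in> hom ?F1 perm_group" "\<Lambda>' \<in> hom ?F2 perm_group"
    using \<Lambda> \<Lambda>' by (auto simp: regular_like_def)
  have "multishift (\<Lambda> c)" "multishift (\<Lambda>' d)"
    using regular_like_multishift[OF g(1) \<Lambda> c(1)] regular_like_multishift[OF g(2) \<Lambda>' d(1)]
      free_group_torsion_free[OF c] free_group_torsion_free[OF d] by blast+
  then obtain q where q: "bij q" "q \<circ> \<Lambda>' d \<circ> inv_into UNIV q = \<Lambda> c"
    by (rule multishift_conjugate)
  define p1 where "p1 j = \<Lambda> [(j, False)]" for j
  define p2 where "p2 j = \<Lambda>' [(j, False)]" for j
  have p1: "eval_word perm_group p1 v = \<Lambda> (reduce v)" if "v \<in> words {..n}" for v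
    using hom_eval_word[OF g(1) group_perm_group hom(1) that generators_in_free_group] that
    by (simp add: eval_word_free_group p1_def[abs_def])
  have p2: "eval_word perm_group p2 v = \<Lambda>' (reduce v)" if "v \<in> words {..m}" for v
    using hom_eval_word[OF g(2) group_perm_group hom(2) that generators_in_free_group] that
    by (simp add: eval_word_free_group p2_def[abs_def])
  have bij1: "bij (p1 j)" if "j \<in> {..n}" for j
    using hom_in_carrier[OF hom(1)] generators_in_free_group[of "{..n}"] that
    unfolding p1_def by (fastforce simp: Pi_iff)
  have bij2: "bij (p2 j)" if "j \<in> {..m}" for j
    using hom_in_carrier[OF hom(2)] generators_in_free_group[of "{..m}"] that
    unfolding p2_def by (fastforce simp: Pi_iff)
  define f where "f = case_sum p1 (\<lambda>j. q \<circ> p2 j \<circ> inv_into UNIV q)"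
  have "f \<in> S \<rightarrow> carrier perm_group"
    using q(1) by (auto simp: f_def bij1 bij2 bij_comp bij_imp_bij_inv)
  moreover have "eval_word perm_group f (inl_word c) = eval_word perm_group f (inr_word d)"
    using q eval_perm_group_conjugate[OF q(1) bij2 d_words] c d
    by (simp add: eval_inl_word eval_inr_word f_def p1 p2 c_words d_words reduce_reduced carrier_free_group)
  ultimately obtain \<tau> where \<tau>: "\<tau> \<in> hom Q perm_group"
    "\<And>w. w \<in> words S \<Longrightarrow> \<tau> (eval_word Q \<iota> w) = eval_word perm_group f w"
    by (rule lift[OF group_perm_group]) (rule that)
  have w: "w \<in> words {..n}" "reduce w = w" using assms(1) by (simp_all add: carrier_free_group reduce_reduced)
  then have "inl_word w \<in> words S" by (auto simp: words_iff inl_word_def)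
  then have "\<tau> \<one>\<^bsub>Q\<^esub> = eval_word perm_group f (inl_word w)"
    using \<tau>(2)[of "inl_word w"] assms(2) by (simp add: eval_inl_word)
  moreover have "\<tau> \<one>\<^bsub>Q\<^esub> = id" using hom_one[OF \<tau>(1) group_Q group_perm_group] by simp
  ultimately have "\<Lambda> w = id" using w by (simp add: eval_inl_word f_def p1)
  then show ?thesis using \<Lambda> assms(1) by (auto simp: regular_like_def)
qed

text \<open>The embedding transfers torsion-freeness from the free group. Hence every nontrivial
  element of the left factor acts as a multishift in a free action of \<open>Q\<close> with
  infinitely many orbits.\<close>

lemma (in amalgam) left_factor_torsion_free:
  assumes "u \<in> words {..n}" "eval_word Q (\<lambda>j. \<iota> (Inl j)) u \<noteq> \<one>\<^bsub>Q\<^esub>" "k > 0"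
  shows "eval_word Q (\<lambda>j. \<iota> (Inl j)) u [^]\<^bsub>Q\<^esub> (k::nat) \<noteq> \<one>\<^bsub>Q\<^esub>"
proof
  let ?h = "eval_word Q (\<lambda>j. \<iota> (Inl j))"
  assume eq: "?h u [^]\<^bsub>Q\<^esub> k = \<one>\<^bsub>Q\<^esub>"
  interpret Q: group Q by (rule group_Q)
  interpret h: group_hom "free_group {..n}" Q ?h
    using Q.eval_word_hom[OF \<iota>_Inl_carrier]
    by (intro group_hom.intro group_hom_axioms.intro free_group_is_group group_Q)
  have r: "?h (reduce u) = ?h u" by (rule Q.eval_word_reduce[OF assms(1) \<iota>_Inl_carrier])
  have u: "reduce u \<in> carrier (free_group {..n})"
    using assms(1) by (simp add: carrier_free_group reduce_in_words)
  then have "?h (reduce u [^]\<^bsub>free_group {..n}\<^esub> k) = \<one>\<^bsub>Q\<^esub>"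
    using eq by (simp add: h.hom_nat_pow r)
  then have "reduce u [^]\<^bsub>free_group {..n}\<^esub> k = []"
    using u by (intro left_factor_embeds h.G.nat_pow_closed)
  then have "reduce u = []"
    using free_group_torsion_free[OF u _ assms(3)] by auto
  then show False using r assms(2) by simp
qed

section \<open>The degree and the subgroup \<open>B\<close>\<close>

locale graded_amalgam = amalgam +
  fixes a0 :: nat
  assumes a0: "a0 \<le> n" "exp_sum a0 c = 0"
begin

definition a where "a = \<iota> (Inl a0)"

lemma a_carrier: "a \<in> carrier Q"
  using \<iota>_carrier a0(1) by (auto simp: a_def)

lemma exp_sum_inl_word: "exp_sum (Inl a0) (inl_word w) = exp_sum a0 w"
  by (induction w) (auto simp: exp_sum_Cons inl_word_def)

lemma exp_sum_inr_word: "exp_sum (Inl a0) (inr_word w) = 0"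
  by (induction w) (auto simp: exp_sum_Cons inr_word_def)

text \<open>Counting \<open>a0\<close> respects the relation: the sum over \<open>c\<close> vanishes
  by assumption, and the letters of \<open>d\<close> come from the other factor.\<close>

lemma ex_degree:
  "\<exists>e \<in> hom Q integer_group. \<forall>w \<in> words S. e (eval_word Q \<iota> w) = exp_sum (Inl a0) w"
proof -
  obtain e where "e \<in> hom Q integer_group" "\<And>w. w \<in> words S \<Longrightarrow>
      e (eval_word Q \<iota> w) = eval_word integer_group (\<lambda>t. if t = Inl a0 then 1 else 0) w"
    using lift[of integer_group "\<lambda>t. if t = Inl a0 then 1 else 0"]
    by (auto simp: eval_word_integer_group exp_sum_inl_word exp_sum_inr_word a0(2))
  then show ?thesis by (auto simp: eval_word_integer_group)
qed

definition e where
  "e = (SOME e. e \<in> hom Q integer_group \<and> (\<forall>w \<in> words S. e (eval_word Q \<iota> w) = exp_sum (Inl a0) w))"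

lemma e_hom: "e \<in> hom Q integer_group"
  and e_eval: "w \<in> words S \<Longrightarrow> e (eval_word Q \<iota> w) = exp_sum (Inl a0) w"
  using someI_ex[of "\<lambda>e. e \<in> hom Q integer_group \<and> (\<forall>w \<in> words S. e (eval_word Q \<iota> w) = exp_sum (Inl a0) w)"]
    ex_degree unfolding e_def by blast+

lemma e_mult: "g \<in> carrier Q \<Longrightarrow> h \<in> carrier Q \<Longrightarrow> e (g \<otimes>\<^bsub>Q\<^esub> h) = e g + e h"
  using hom_mult[OF e_hom] by simp

lemma e_\<iota>: "s \<in> S \<Longrightarrow> e (\<iota> s) = (if s = Inl a0 then 1 else 0)"
proof -
  assume s: "s \<in> S"
  interpret Q: group Q by (rule group_Q)
  have "\<iota> s \<in> carrier Q" using s \<iota>_carrier by (rule funcset_mem[rotated])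
  then have "eval_word Q \<iota> [(s, False)] = \<iota> s" by (simp add: eval_word_Cons)
  then show ?thesis using e_eval[of "[(s, False)]"] s by (simp add: exp_sum_Cons)
qed

lemma e_a: "e a = 1"
  using e_\<iota>[of "Inl a0"] a0(1) by (simp add: a_def)

text \<open>As only \<open>l \<ge> 0\<close> is allowed, conjugation by \<open>a\<close> maps
  \<open>B\<close> into itself. The subgroups \<open>a [^] (- k) B a [^] k\<close> thus increase
  with \<open>k\<close>, and they exhaust the kernel of \<open>e\<close>.\<close>

definition B where
  "B = generate Q {a [^]\<^bsub>Q\<^esub> l \<otimes>\<^bsub>Q\<^esub> \<iota> s \<otimes>\<^bsub>Q\<^esub> a [^]\<^bsub>Q\<^esub> (- l) | l s. (0::int) \<le> l \<and> s \<in> S - {Inl a0}}"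

lemma B_generators: "{a [^]\<^bsub>Q\<^esub> l \<otimes>\<^bsub>Q\<^esub> \<iota> s \<otimes>\<^bsub>Q\<^esub> a [^]\<^bsub>Q\<^esub> (- l) | l s. (0::int) \<le> l \<and> s \<in> S - {Inl a0}}
    \<subseteq> carrier Q"
proof -
  interpret Q: group Q by (rule group_Q)
  show ?thesis using a_carrier \<iota>_carrier by (auto simp: Pi_iff)
qed

lemma subgroup_B: "subgroup B Q"
  unfolding B_def by (rule group.generate_is_subgroup[OF group_Q B_generators])

lemma group_hom_e: "group_hom Q integer_group e"
  by (intro group_hom.intro group_hom_axioms.intro group_Q e_hom group_integer_group)

lemma e_a_pow: "e (a [^]\<^bsub>Q\<^esub> z) = z" for z :: int
proof -
  interpret Q: group Q by (rule group_Q)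
  interpret group_hom Q integer_group e by (rule group_hom_e)
  show ?thesis using hom_int_pow[OF a_carrier, of z] by (simp add: e_a)
qed

lemma e_B: "b \<in> B \<Longrightarrow> e b = 0"
proof -
  interpret Q: group Q by (rule group_Q)
  interpret e: group_hom Q integer_group e by (rule group_hom_e)
  have "subgroup (kernel Q integer_group e) Q" by (rule e.subgroup_kernel)
  moreover have "{a [^]\<^bsub>Q\<^esub> l \<otimes>\<^bsub>Q\<^esub> \<iota> s \<otimes>\<^bsub>Q\<^esub> a [^]\<^bsub>Q\<^esub> (- l) | l s. (0::int) \<le> l \<and> s \<in> S - {Inl a0}}
      \<subseteq> kernel Q integer_group e"
    using B_generators a_carrier \<iota>_carrier by (auto simp: kernel_def e_mult Pi_iff e_a_pow e_\<iota>)
  ultimately have "B \<subseteq> kernel Q integer_group e"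
    unfolding B_def by (rule Q.generate_subgroup_incl[rotated])
  then show "b \<in> B \<Longrightarrow> e b = 0" by (auto simp: kernel_def)
qed

text \<open>Read the word from the left, keeping track of the power of \<open>a\<close> in front. A
  letter \<open>a0\<close> changes this power by one; any other letter is split off as a generator
  of \<open>B\<close> or its inverse. The bound on the length keeps the power nonnegative
  throughout.\<close>

lemma absorb_word:
  assumes "w \<in> words S" "int (length w) \<le> k"
  shows "a [^]\<^bsub>Q\<^esub> k \<otimes>\<^bsub>Q\<^esub> eval_word Q \<iota> w \<otimes>\<^bsub>Q\<^esub> a [^]\<^bsub>Q\<^esub> (- (k + exp_sum (Inl a0) w)) \<in> B"
  using assms
proof (induction w arbitrary: k)
  case Nil
  interpret Q: group Q by (rule group_Q)
  show ?case
    using a_carrier subgroup.one_closed[OF subgroup_B] by (simp add: Q.int_pow_neg)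
next
  case (Cons x w)
  interpret Q: group Q by (rule group_Q)
  obtain s b where x: "x = (s, b)" by force
  have s: "s \<in> S" and w: "w \<in> words S" using Cons.hyps x by auto
  define v where "v = eval_word Q \<iota> w"
  define z where "z = exp_sum (Inl a0) w"
  have v: "v \<in> carrier Q" unfolding v_def using w \<iota>_carrier by (rule Q.eval_word_closed)
  have \<iota>s: "\<iota> s \<in> carrier Q" using s \<iota>_carrier by auto
  show ?case
  proof (cases "s = Inl a0")
    case True
    define \<epsilon> :: int where "\<epsilon> = (if b then -1 else 1)"
    have letter: "eval_word Q \<iota> (x # w) = a [^]\<^bsub>Q\<^esub> \<epsilon> \<otimes>\<^bsub>Q\<^esub> v"
      using a_carrier by (simp add: x True \<epsilon>_def v_def eval_word_Cons a_def Q.int_pow_neg)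
    \<comment> \<open>The letter merges into the power of \<open>a\<close>; \<open>k\<close> exceeds
      the length of \<open>w\<close> by at least one, so the hypothesis still applies if the power
      drops.\<close>
    have "a [^]\<^bsub>Q\<^esub> (k + \<epsilon>) \<otimes>\<^bsub>Q\<^esub> v \<otimes>\<^bsub>Q\<^esub> a [^]\<^bsub>Q\<^esub> (- ((k + \<epsilon>) + z)) \<in> B"
      unfolding v_def z_def using w Cons.prems by (intro Cons.IH) (simp_all add: \<epsilon>_def)
    moreover have "exp_sum (Inl a0) (x # w) = \<epsilon> + z"
      by (simp add: exp_sum_Cons x True \<epsilon>_def z_def)
    ultimately show ?thesis
      unfolding letter using a_carrier v by (simp add: Q.int_pow_mult Q.m_assoc add.assoc)
  next
    case False
    define y where "y = (if b then inv\<^bsub>Q\<^esub> (\<iota> s) else \<iota> s)"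
    have y: "y \<in> carrier Q" using \<iota>s by (simp add: y_def)
    have "a [^]\<^bsub>Q\<^esub> k \<otimes>\<^bsub>Q\<^esub> \<iota> s \<otimes>\<^bsub>Q\<^esub> a [^]\<^bsub>Q\<^esub> (- k) \<in> B"
      unfolding B_def using s False Cons.prems by (intro generate.incl CollectI exI[of _ k] exI[of _ s]) simp
    moreover from this have "inv\<^bsub>Q\<^esub> (a [^]\<^bsub>Q\<^esub> k \<otimes>\<^bsub>Q\<^esub> \<iota> s \<otimes>\<^bsub>Q\<^esub> a [^]\<^bsub>Q\<^esub> (- k)) \<in> B"
      by (rule subgroup.m_inv_closed[OF subgroup_B])
    ultimately have "a [^]\<^bsub>Q\<^esub> k \<otimes>\<^bsub>Q\<^esub> y \<otimes>\<^bsub>Q\<^esub> a [^]\<^bsub>Q\<^esub> (- k) \<in> B"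
      using a_carrier \<iota>s by (cases b) (simp_all add: y_def Q.inv_mult_group Q.int_pow_neg Q.m_assoc)
    moreover have "a [^]\<^bsub>Q\<^esub> k \<otimes>\<^bsub>Q\<^esub> v \<otimes>\<^bsub>Q\<^esub> a [^]\<^bsub>Q\<^esub> (- (k + z)) \<in> B"
      unfolding v_def z_def using w Cons.prems by (intro Cons.IH) simp_all
    \<comment> \<open>Cancelling powers of \<open>a\<close> are inserted between the letter and the
      rest of the word, which splits the conjugate into two factors from \<open>B\<close>.\<close>
    ultimately have "(a [^]\<^bsub>Q\<^esub> k \<otimes>\<^bsub>Q\<^esub> y \<otimes>\<^bsub>Q\<^esub> a [^]\<^bsub>Q\<^esub> (- k)) \<otimes>\<^bsub>Q\<^esub>
        (a [^]\<^bsub>Q\<^esub> k \<otimes>\<^bsub>Q\<^esub> v \<otimes>\<^bsub>Q\<^esub> a [^]\<^bsub>Q\<^esub> (- (k + z))) \<in> B"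
      by (rule subgroup.m_closed[OF subgroup_B])
    moreover have "a [^]\<^bsub>Q\<^esub> (- k) \<otimes>\<^bsub>Q\<^esub> (a [^]\<^bsub>Q\<^esub> k \<otimes>\<^bsub>Q\<^esub> t) = t" if "t \<in> carrier Q" for t
      using a_carrier that by (simp add: Q.int_pow_neg Q.inv_mult_cancel)
    moreover have "eval_word Q \<iota> (x # w) = y \<otimes>\<^bsub>Q\<^esub> v" "exp_sum (Inl a0) (x # w) = z"
      using False by (simp_all add: x y_def v_def z_def eval_word_Cons exp_sum_Cons)
    ultimately show ?thesis
      using a_carrier v y by (simp add: Q.m_assoc)
  qed
qed

end

lemma inv_into_UNIV_eqI: "bij f \<Longrightarrow> f q = p \<Longrightarrow> inv_into UNIV f p = q"
  by (auto simp: bij_is_inj)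

context graded_amalgam
begin

section \<open>Truncating the regular representation\<close>

text \<open>A regular representation \<open>P\<close> of \<open>Q\<close> on \<open>\<nat>\<close> is spread over \<open>\<int> \<times> \<nat>\<close> by letting \<open>a0\<close> raise the level,
  and then truncated: at the levels up to \<open>-K\<close> the other generators of the left factor act trivially.\<close>

definition truncated :: "int \<Rightarrow> (nat \<Rightarrow> nat \<Rightarrow> nat) \<Rightarrow> nat \<Rightarrow> int \<times> nat \<Rightarrow> int \<times> nat" where
  "truncated K P j = (\<lambda>(i, t). if j = a0 then (i + 1, P j t) else if i > - K then (i, P j t) else (i, t))"

lemma truncated_apply:
  "truncated K P j (i, t) = (if j = a0 then (i + 1, P j t) else if i > - K then (i, P j t) else (i, t))"
  by (simp add: truncated_def)

lemma bij_truncated: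
  assumes "bij (P j)"
  shows "bij (truncated K P j)"
proof (rule o_bij)
  let ?g = "\<lambda>(i, t). if j = a0 then (i - 1, inv_into UNIV (P j) t)
    else if i > - K then (i, inv_into UNIV (P j) t) else (i, t)"
  show "?g \<circ> truncated K P j = id" "truncated K P j \<circ> ?g = id"
    using assms by (auto simp: fun_eq_iff truncated_apply bij_is_inj bij_is_surj surj_f_inv_f)
qed

lemma inv_truncated:
  assumes "bij (P j)"
  shows "inv_into UNIV (truncated K P j) (i, t) =
    (if j = a0 then (i - 1, inv_into UNIV (P j) t)
     else if i > - K then (i, inv_into UNIV (P j) t) else (i, t))"
  using assms by (intro inv_into_UNIV_eqI bij_truncated) (auto simp: truncated_apply bij_is_surj surj_f_inv_f)

text \<open>On each level, a word acts through the word obtained by deleting the letters that are read at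
  truncated levels.\<close>

lemma eval_truncated:
  assumes "w \<in> words {..n}" and P: "\<And>j. j \<in> {..n} \<Longrightarrow> bij (P j)"
  shows "\<exists>u \<in> words {..n}. exp_sum a0 u = exp_sum a0 w \<and>
    (i > - K + int (length w) \<longrightarrow> u = w) \<and>
    (i \<le> - K - int (length w) \<longrightarrow> fst ` set u \<subseteq> {a0}) \<and>
    (\<forall>t. eval_word perm_group (truncated K P) w (i, t) = (i + exp_sum a0 w, eval_word perm_group P u t))"
  using assms(1)
proof (induction w)
  case Nil
  then show ?case by (intro bexI[of _ "[]"]) auto
next
  case (Cons x w)
  obtain j b where x: "x = (j, b)" by force
  have j: "j \<in> {..n}" using Cons.hyps x by auto
  have bij: "bij (P j)" "bij (truncated K P j)" using P[OF j] bij_truncated[of P j K] by auto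
  from Cons.IH obtain u where u: "u \<in> words {..n}" "exp_sum a0 u = exp_sum a0 w"
    "i > - K + int (length w) \<Longrightarrow> u = w"
    "i \<le> - K - int (length w) \<Longrightarrow> fst ` set u \<subseteq> {a0}"
    "\<And>t. eval_word perm_group (truncated K P) w (i, t) = (i + exp_sum a0 w, eval_word perm_group P u t)"
    by blast
  \<comment> \<open>The level never moves by more than the number of letters read, so far above the
    threshold no letter is deleted and far below only \<open>a0\<close> survives.\<close>
  have len: "\<bar>exp_sum a0 w\<bar> \<le> int (length w)" by (rule abs_exp_sum_le)
  show ?case
  \<comment> \<open>The rest of the word acts first, so the letter \<open>x\<close> is read at level
    \<open>i + exp_sum a0 w\<close>.\<close>
  proof (cases "j = a0 \<or> i + exp_sum a0 w > - K")
    case True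
    show ?thesis
      by (rule bexI[of _ "x # u"]) (use True len u j bij in
        \<open>auto simp: x exp_sum_Cons inv_truncated truncated_apply\<close>)
  next
    case False
    show ?thesis
      by (rule bexI[of _ u]) (use False len u j bij in
        \<open>auto simp: x exp_sum_Cons inv_truncated truncated_apply\<close>)
  qed
qed

text \<open>Applied to what is left of \<open>c\<close> at the lowest levels: only letters
  \<open>a0\<close> survive there, with exponent sum zero, so \<open>c\<close> acts
  trivially.\<close>

lemma eval_power_word:
  assumes "u \<in> words {..n}" "fst ` set u \<subseteq> {a0}"
  shows "eval_word Q (\<lambda>j. \<iota> (Inl j)) u = a [^]\<^bsub>Q\<^esub> exp_sum a0 u"
  using assms(2)
proof (induction u)
  case (Cons x u)
  interpret Q: group Q by (rule group_Q)
  show ?case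
    using Cons a_carrier by (auto simp: eval_word_Cons exp_sum_Cons Q.int_pow_mult Q.int_pow_neg a_def[symmetric])
qed simp

text \<open>At the intermediate levels, \<open>c\<close> acts through an element \<open>u\<close> of the left factor. If \<open>u\<close> is
  nontrivial, then both it and \<open>d\<close> act as multishifts, so the right factor can be conjugated to match.\<close>

lemma ex_compatible_right_action:
  assumes \<Lambda>: "regular_like Q \<Lambda>" and u: "u \<in> words {..n}"
  shows "\<exists>R. (\<forall>j\<in>{..m}. bij (R j)) \<and>
    eval_word perm_group R d = \<Lambda> (eval_word Q (\<lambda>j. \<iota> (Inl j)) u) \<and>
    (u = c \<longrightarrow> R = (\<lambda>j. \<Lambda> (\<iota> (Inr j)))) \<and>
    (eval_word Q (\<lambda>j. \<iota> (Inl j)) u = \<one>\<^bsub>Q\<^esub> \<longrightarrow> R = (\<lambda>j. id))"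
proof -
  let ?h = "eval_word Q (\<lambda>j. \<iota> (Inl j))"
  have hom: "\<Lambda> \<in> hom Q perm_group" using \<Lambda> by (simp add: regular_like_def)
  interpret Q: group Q by (rule group_Q)
  \<comment> \<open>Besides giving a multishift, this shows that the last two clauses of the claim
    never apply together.\<close>
  have c1: "?h c \<noteq> \<one>\<^bsub>Q\<^esub>" using left_factor_embeds[OF c(1)] c(2) by blast
  have bij: "bij (\<Lambda> (\<iota> (Inr j)))" if "j \<in> {..m}" for j
    using hom_in_carrier[OF hom funcset_mem[OF \<iota>_Inr_carrier that]] by simp
  have d_eval: "eval_word perm_group (\<lambda>j. \<Lambda> (\<iota> (Inr j))) d = \<Lambda> (?h c)"
    using hom_eval_word[OF group_Q group_perm_group hom d_words \<iota>_Inr_carrier] by (simp add: relation)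
  have multishift: "multishift (\<Lambda> (?h v))" if "v \<in> words {..n}" "?h v \<noteq> \<one>\<^bsub>Q\<^esub>" for v
    using left_factor_torsion_free[OF that] Q.eval_word_closed[OF that(1) \<iota>_Inl_carrier]
    by (intro regular_like_multishift[OF group_Q \<Lambda>])
  consider "u = c" | "u \<noteq> c" "?h u = \<one>\<^bsub>Q\<^esub>" | "u \<noteq> c" "?h u \<noteq> \<one>\<^bsub>Q\<^esub>" by blast
  then show ?thesis
  proof cases
    case 1
    then show ?thesis using bij d_eval c1 by (intro exI[of _ "\<lambda>j. \<Lambda> (\<iota> (Inr j))"]) simp
  next
    case 2
    have "inv\<^bsub>perm_group\<^esub> (id :: nat \<Rightarrow> nat) = id"
      by (simp add: bij_id inv_id)
    then have "eval_word perm_group (\<lambda>j. id) w = (id :: nat \<Rightarrow> nat)" for w :: "(nat \<times> bool) list"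
      by (induction w) (simp_all add: eval_word_Cons)
    moreover have "\<Lambda> \<one>\<^bsub>Q\<^esub> = id" using hom_one[OF hom group_Q group_perm_group] by simp
    ultimately show ?thesis using 2 by (intro exI[of _ "\<lambda>j. id"]) simp
  next
    case 3
    \<comment> \<open>By the relation, \<open>\<Lambda> (?h c)\<close> is also the action of
      \<open>d\<close>, which is therefore the permutation to be conjugated.\<close>
    obtain q where q: "bij q" "q \<circ> \<Lambda> (?h c) \<circ> inv_into UNIV q = \<Lambda> (?h u)"
      using multishift_conjugate[OF multishift[OF u 3(2)] multishift[OF c_words c1]] .
    have "eval_word perm_group (\<lambda>j. q \<circ> \<Lambda> (\<iota> (Inr j)) \<circ> inv_into UNIV q) d = \<Lambda> (?h u)"
      using eval_perm_group_conjugate[OF q(1) bij d_words] q(2) by (simp add: d_eval)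
    moreover have "bij (q \<circ> \<Lambda> (\<iota> (Inr j)) \<circ> inv_into UNIV q)" if "j \<in> {..m}" for j
      using q(1) bij[OF that] by (intro bij_comp bij_imp_bij_inv)
    ultimately show ?thesis
      using 3 by (intro exI[of _ "\<lambda>j. q \<circ> \<Lambda> (\<iota> (Inr j)) \<circ> inv_into UNIV q"]) simp
  qed
qed

text \<open>Having exponent sum zero, \<open>c\<close> preserves every level under the truncated
  left action. The right action can therefore be chosen level by level so that \<open>d\<close>
  agrees with \<open>c\<close>: the original one at high levels, the trivial one at low
  levels.\<close>

lemma ex_truncated_action:
  assumes \<Lambda>: "regular_like Q \<Lambda>"
  obtains \<tau> where "\<tau> \<in> hom Q perm_group"
    "\<And>g i t. g \<in> carrier Q \<Longrightarrow> fst (\<tau> g (i, t)) = i + e g"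
    "\<And>w i t. w \<in> words S \<Longrightarrow> i > - K + int (length c) + int (length w) \<Longrightarrow>
      \<tau> (eval_word Q \<iota> w) (i, t) = (i + e (eval_word Q \<iota> w), \<Lambda> (eval_word Q \<iota> w) t)"
    "\<And>s i t. s \<in> S \<Longrightarrow> s \<noteq> Inl a0 \<Longrightarrow> i \<le> - K - int (length c) \<Longrightarrow> \<tau> (\<iota> s) (i, t) = (i, t)"
proof -
  let ?h = "eval_word Q (\<lambda>j. \<iota> (Inl j))"
  have hom: "\<Lambda> \<in> hom Q perm_group" using \<Lambda> by (simp add: regular_like_def)
  interpret Q: group Q by (rule group_Q)
  define P where "P s = \<Lambda> (\<iota> s)" for s
  have P: "bij (P s)" if "s \<in> S" for s
    using hom_in_carrier[OF hom funcset_mem[OF \<iota>_carrier that]] by (simp add: P_def)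
  have PL: "bij (P (Inl j))" if "j \<in> {..n}" for j using that by (intro P) simp
  have P_eval: "eval_word perm_group P w = \<Lambda> (eval_word Q \<iota> w)" if "w \<in> words S" for w
    using hom_eval_word[OF group_Q group_perm_group hom that \<iota>_carrier] by (simp add: P_def[abs_def])
  have PL_eval: "eval_word perm_group (\<lambda>j. P (Inl j)) u = \<Lambda> (?h u)" if "u \<in> words {..n}" for u
    using hom_eval_word[OF group_Q group_perm_group hom that \<iota>_Inl_carrier] by (simp add: P_def[abs_def])
  define T1 where "T1 = truncated K (\<lambda>j. P (Inl j))"
  have T1: "bij (T1 j)" if "j \<in> {..n}" for j
    unfolding T1_def using PL[OF that] by (rule bij_truncated[of "\<lambda>j. P (Inl j)" j])
  have "\<forall>i. \<exists>R. (\<forall>j\<in>{..m}. bij (R j)) \<and>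
      (\<forall>t. eval_word perm_group T1 c (i, t) = (i, eval_word perm_group R d t)) \<and>
      (i > - K + int (length c) \<longrightarrow> R = (\<lambda>j. P (Inr j))) \<and>
      (i \<le> - K - int (length c) \<longrightarrow> R = (\<lambda>j. id))"
  proof
    fix i
    have "\<exists>u \<in> words {..n}. exp_sum a0 u = 0 \<and>
        (i > - K + int (length c) \<longrightarrow> u = c) \<and>
        (i \<le> - K - int (length c) \<longrightarrow> fst ` set u \<subseteq> {a0}) \<and>
        (\<forall>t. eval_word perm_group T1 c (i, t) = (i, eval_word perm_group (\<lambda>j. P (Inl j)) u t))"
      using eval_truncated[OF c_words, of "\<lambda>j. P (Inl j)" K i] PL a0(2) unfolding T1_def by simp
    then obtain u where u: "u \<in> words {..n}" "exp_sum a0 u = 0"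
      "i > - K + int (length c) \<Longrightarrow> u = c"
      "i \<le> - K - int (length c) \<Longrightarrow> fst ` set u \<subseteq> {a0}"
      "\<And>t. eval_word perm_group T1 c (i, t) = (i, eval_word perm_group (\<lambda>j. P (Inl j)) u t)"
      by blast
    obtain R where R: "\<forall>j\<in>{..m}. bij (R j)" "eval_word perm_group R d = \<Lambda> (?h u)"
      "u = c \<Longrightarrow> R = (\<lambda>j. P (Inr j))" "?h u = \<one>\<^bsub>Q\<^esub> \<Longrightarrow> R = (\<lambda>j. id)"
      using ex_compatible_right_action[OF \<Lambda> u(1)]
      by (elim exE conjE) (rule that, simp_all add: P_def)
    \<comment> \<open>At these levels \<open>u\<close> consists of letters \<open>a0\<close> and
      their inverses, equally many of each.\<close>
    have "?h u = \<one>\<^bsub>Q\<^esub>" if "i \<le> - K - int (length c)"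
      using eval_power_word[OF u(1) u(4)[OF that]] u(2) by simp
    then show "\<exists>R. (\<forall>j\<in>{..m}. bij (R j)) \<and>
      (\<forall>t. eval_word perm_group T1 c (i, t) = (i, eval_word perm_group R d t)) \<and>
      (i > - K + int (length c) \<longrightarrow> R = (\<lambda>j. P (Inr j))) \<and>
      (i \<le> - K - int (length c) \<longrightarrow> R = (\<lambda>j. id))"
      using R u by (intro exI[of _ R]) (simp add: PL_eval)
  qed
  then obtain R where R: "\<And>i j. j \<in> {..m} \<Longrightarrow> bij (R i j)"
    "\<And>i t. eval_word perm_group T1 c (i, t) = (i, eval_word perm_group (R i) d t)"
    "\<And>i. i > - K + int (length c) \<Longrightarrow> R i = (\<lambda>j. P (Inr j))"
    "\<And>i. i \<le> - K - int (length c) \<Longrightarrow> R i = (\<lambda>j. id)"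
    by metis
  define T2 where "T2 j p = (fst p, R (fst p) j (snd p))" for j p
  have T2: "bij (T2 j)" if "j \<in> {..m}" for j
  proof (rule o_bij)
    let ?g = "\<lambda>(i, t). (i, inv_into UNIV (R i j) t)"
    show "?g \<circ> T2 j = id" "T2 j \<circ> ?g = id"
      using R(1)[OF that] by (auto simp: fun_eq_iff T2_def bij_is_inj bij_is_surj surj_f_inv_f)
  qed
  have T2_inv: "inv_into UNIV (T2 j) (i, t) = (i, inv_into UNIV (R i j) t)" if "j \<in> {..m}" for i j t
    using R(1)[OF that] T2[OF that]
    by (intro inv_into_UNIV_eqI) (auto simp: T2_def bij_is_surj surj_f_inv_f)
  have T2_eval: "eval_word perm_group T2 w (i, t) = (i, eval_word perm_group (R i) w t)"
    if "w \<in> words {..m}" for w i t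
    using that
  proof (induction w)
    case (Cons x w)
    then have "fst x \<in> {..m}" by auto
    with Cons show ?case by (simp add: T2 R(1) T2_inv) (simp add: T2_def)
  qed simp
  define T where "T = case_sum T1 T2"
  have T: "bij (T s)" if "s \<in> S" for s
    using that T1 T2 by (auto simp: T_def)
  have "eval_word perm_group T (inl_word c) = eval_word perm_group T (inr_word d)"
    using R(2) T2_eval[OF d_words] by (simp add: T_def eval_inl_word eval_inr_word fun_eq_iff)
  then obtain \<tau> where \<tau>: "\<tau> \<in> hom Q perm_group"
    "\<And>w. w \<in> words S \<Longrightarrow> \<tau> (eval_word Q \<iota> w) = eval_word perm_group T w"
    using lift[OF group_perm_group, of T] T by (auto simp: Pi_iff)
  have T_letter: "(if snd x then inv_into UNIV (T (fst x)) else T (fst x)) (i, t) =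
      (i + exp_sum (Inl a0) [x], (if snd x then inv_into UNIV (P (fst x)) else P (fst x)) t)"
    if "fst x \<in> S" "i > - K + int (length c)" for x i t
  proof (cases "fst x")
    case (Inl j)
    then have j: "j \<in> {..n}" using that(1) by auto
    then show ?thesis
      using that(2) Inl PL[OF j] inv_truncated[of "\<lambda>j. P (Inl j)" j K i t]
      by (auto simp: T_def T1_def exp_sum_Cons truncated_apply)
  next
    case (Inr j)
    then have j: "j \<in> {..m}" using that(1) by auto
    then show ?thesis
      using that(2) Inr T2_inv[OF j, of i t] R(3)[of i]
      by (auto simp: T_def exp_sum_Cons T2_def)
  qed
  \<comment> \<open>The level sinks by at most the length of the word, so every letter is read where
    both factors act as in \<open>\<Lambda>\<close>.\<close>
  have T_real: "eval_word perm_group T w (i, t) = (i + exp_sum (Inl a0) w, eval_word perm_group P w t)"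
    if "w \<in> words S" "i > - K + int (length c) + int (length w)" for w i t
    using that
  proof (induction w)
    case (Cons x w)
    then have x: "fst x \<in> S" by auto
    have "i + exp_sum (Inl a0) w > - K + int (length c)"
      using abs_exp_sum_le[of "Inl a0" w] Cons.prems by simp
    from T_letter[OF x this] show ?case
      using Cons T[OF x] P[OF x] by (simp add: exp_sum_Cons[of _ x w] exp_sum_Cons[of _ x "[]"])
  qed simp
  have T_fst_letter: "fst ((if snd x then inv_into UNIV (T (fst x)) else T (fst x)) p) =
      fst p + exp_sum (Inl a0) [x]" if "fst x \<in> S" for x p
  proof (cases "fst x")
    case (Inl j)
    then have j: "j \<in> {..n}" using that(1) by auto
    then show ?thesis
      using Inl PL[OF j] inv_truncated[of "\<lambda>j. P (Inl j)" j K "fst p" "snd p"]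
      by (cases p) (auto simp: T_def T1_def exp_sum_Cons truncated_apply)
  next
    case (Inr j)
    then have j: "j \<in> {..m}" using that(1) by auto
    then show ?thesis
      using Inr T2_inv[OF j, of "fst p" "snd p"]
      by (cases p) (auto simp: T_def exp_sum_Cons T2_def)
  qed
  have T_fst: "fst (eval_word perm_group T w p) = fst p + exp_sum (Inl a0) w" if "w \<in> words S" for w p
    using that
  proof (induction w)
    case (Cons x w)
    then have x: "fst x \<in> S" by auto
    show ?case
      using Cons T[OF x] T_fst_letter[OF x] by (simp add: exp_sum_Cons[of _ x w] exp_sum_Cons[of _ x "[]"])
  qed simp
  show ?thesis
  proof (rule that[OF \<tau>(1)])
    show "fst (\<tau> g (i, t)) = i + e g" if "g \<in> carrier Q" for g i t
      using that by (elim Q_cases) (simp add: \<tau>(2) T_fst e_eval)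
    show "\<tau> (eval_word Q \<iota> w) (i, t) = (i + e (eval_word Q \<iota> w), \<Lambda> (eval_word Q \<iota> w) t)"
      if "w \<in> words S" "i > - K + int (length c) + int (length w)" for w i t
      using that by (simp add: \<tau>(2) T_real e_eval P_eval)
    show "\<tau> (\<iota> s) (i, t) = (i, t)" if s: "s \<in> S" "s \<noteq> Inl a0" "i \<le> - K - int (length c)" for s i t
    proof -
      have "\<iota> s \<in> carrier Q" using s(1) \<iota>_carrier by (rule funcset_mem[rotated])
      then have "\<tau> (\<iota> s) = T s" using \<tau>(2)[of "[(s, False)]"] s(1) T[OF s(1)] by (simp add: eval_word_Cons)
      moreover have "i \<le> - K" using s(3) by linarith
      ultimately show ?thesis
        using s R(4)[of i] by (cases s) (simp_all add: T_def T1_def T2_def truncated_apply)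
    qed
  qed
qed

section \<open>Conjugates of \<open>B\<close> and the conclusion\<close>

text \<open>Truncate so far down that \<open>g\<close> still acts regularly at level 0 and hence
  moves every point there. Elements of \<open>B\<close> fix all points at low levels, so if
  \<open>B\<close> contained the conjugate of \<open>g\<close> by a large power of \<open>a\<close>,
  then \<open>g\<close> would fix a point at level 0.\<close>

lemma core_free:
  assumes "g \<in> carrier Q" "g \<noteq> \<one>\<^bsub>Q\<^esub>"
  shows "\<exists>k0::int. \<forall>k\<ge>k0. a [^]\<^bsub>Q\<^esub> (- k) \<otimes>\<^bsub>Q\<^esub> g \<otimes>\<^bsub>Q\<^esub> a [^]\<^bsub>Q\<^esub> k \<notin> B"
proof -
  interpret Q: group Q by (rule group_Q)
  obtain \<Lambda> where \<Lambda>: "regular_like Q \<Lambda>" using Q.ex_regular_like countable_Q by blast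
  obtain w where w: "w \<in> words S" "g = eval_word Q \<iota> w" using assms(1) by (rule Q_cases)
  \<comment> \<open>The summand 1 makes level 0 lie strictly above the bound required for
    \<open>w\<close> to act regularly.\<close>
  define K where "K = int (length c) + int (length w) + 1"
  define L where "L = K + int (length c)"
  obtain \<tau> where hom: "\<tau> \<in> hom Q perm_group"
    and level: "\<And>g i t. g \<in> carrier Q \<Longrightarrow> fst (\<tau> g (i, t)) = i + e g"
    and regular: "\<And>w i t. w \<in> words S \<Longrightarrow> i > - K + int (length c) + int (length w) \<Longrightarrow>
      \<tau> (eval_word Q \<iota> w) (i, t) = (i + e (eval_word Q \<iota> w), \<Lambda> (eval_word Q \<iota> w) t)"
    and trivial: "\<And>s i t. s \<in> S \<Longrightarrow> s \<noteq> Inl a0 \<Longrightarrow> i \<le> - K - int (length c) \<Longrightarrow> \<tau> (\<iota> s) (i, t) = (i, t)"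
    by (rule ex_truncated_action[OF \<Lambda>, of K]) (rule that)
  interpret \<tau>: group_hom Q perm_group \<tau>
    by (intro group_hom.intro group_hom_axioms.intro group_Q group_perm_group hom)
  have \<tau>_mult: "\<tau> (g \<otimes>\<^bsub>Q\<^esub> h) p = \<tau> g (\<tau> h p)" if "g \<in> carrier Q" "h \<in> carrier Q" for g h p
    using \<tau>.hom_mult[OF that] by simp
  have \<tau>_one: "\<tau> \<one>\<^bsub>Q\<^esub> p = p" for p using \<tau>.hom_one by simp
  have conj: "\<tau> (a [^]\<^bsub>Q\<^esub> l) (\<tau> (a [^]\<^bsub>Q\<^esub> (- l)) p) = p" for l :: int and p
  proof -
    have "a [^]\<^bsub>Q\<^esub> l \<otimes>\<^bsub>Q\<^esub> a [^]\<^bsub>Q\<^esub> (- l) = \<one>\<^bsub>Q\<^esub>" using a_carrier by (simp add: Q.int_pow_neg)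
    then show ?thesis
      using \<tau>_mult[of "a [^]\<^bsub>Q\<^esub> l" "a [^]\<^bsub>Q\<^esub> (- l)" p] a_carrier by (simp only: \<tau>_one Q.int_pow_closed)
  qed
  have generator_trivial: "h \<in> carrier Q \<and> (\<forall>i\<le>-L. \<forall>t. \<tau> h (i, t) = (i, t))"
    if gen: "h \<in> {a [^]\<^bsub>Q\<^esub> l \<otimes>\<^bsub>Q\<^esub> \<iota> s \<otimes>\<^bsub>Q\<^esub> a [^]\<^bsub>Q\<^esub> (- l) | l s. (0::int) \<le> l \<and> s \<in> S - {Inl a0}}" for h
  proof -
    obtain l :: int and s where h: "h = a [^]\<^bsub>Q\<^esub> l \<otimes>\<^bsub>Q\<^esub> \<iota> s \<otimes>\<^bsub>Q\<^esub> a [^]\<^bsub>Q\<^esub> (- l)"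
      and l: "0 \<le> l" and s: "s \<in> S" "s \<noteq> Inl a0"
      using gen by blast
    have \<iota>s: "\<iota> s \<in> carrier Q" using s(1) \<iota>_carrier by (rule funcset_mem[rotated])
    have "\<tau> h (i, t) = (i, t)" if "i \<le> - L" for i t
    proof -
      \<comment> \<open>Here \<open>l \<ge> 0\<close> is essential: the power of \<open>a\<close>
        only leads further down, where the generator \<open>\<iota> s\<close> acts
        trivially.\<close>
      obtain t' where t': "\<tau> (a [^]\<^bsub>Q\<^esub> (- l)) (i, t) = (i - l, t')"
        using level[of "a [^]\<^bsub>Q\<^esub> (- l)" i t] a_carrier
        by (cases "\<tau> (a [^]\<^bsub>Q\<^esub> (- l)) (i, t)") (simp add: e_a_pow)
      have "\<tau> h (i, t) = \<tau> (a [^]\<^bsub>Q\<^esub> l) (\<tau> (\<iota> s) (i - l, t'))"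
        using a_carrier \<iota>s by (simp add: h \<tau>_mult t')
      also have "\<dots> = \<tau> (a [^]\<^bsub>Q\<^esub> l) (i - l, t')" using that l by (simp add: trivial[OF s] L_def)
      also have "\<dots> = (i, t)" using conj[of l "(i, t)"] by (simp add: t')
      finally show ?thesis .
    qed
    then show ?thesis using h a_carrier \<iota>s by simp
  qed
  have B_trivial: "b \<in> carrier Q \<and> (\<forall>i\<le>-L. \<forall>t. \<tau> b (i, t) = (i, t))" if "b \<in> B" for b
    using that unfolding B_def
  proof (induction rule: generate.induct)
    case (incl h)
    then show ?case by (rule generator_trivial)
  next
    case (inv h)
    from generator_trivial[OF this]
    have h: "h \<in> carrier Q" "\<And>i t. i \<le> - L \<Longrightarrow> \<tau> h (i, t) = (i, t)" by auto
    have "\<tau> (inv\<^bsub>Q\<^esub> h) (i, t) = (i, t)" if "i \<le> - L" for i t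
      using \<tau>_mult[of "inv\<^bsub>Q\<^esub> h" h "(i, t)"] h(1) h(2)[OF that, of t] by (simp add: \<tau>_one)
    then show ?case using h(1) by simp
  qed (auto simp: \<tau>_one \<tau>_mult)
  have "a [^]\<^bsub>Q\<^esub> (- k) \<otimes>\<^bsub>Q\<^esub> g \<otimes>\<^bsub>Q\<^esub> a [^]\<^bsub>Q\<^esub> k \<notin> B" if k_ge: "k \<ge> L" for k
  proof
    assume b: "a [^]\<^bsub>Q\<^esub> (- k) \<otimes>\<^bsub>Q\<^esub> g \<otimes>\<^bsub>Q\<^esub> a [^]\<^bsub>Q\<^esub> k \<in> B"
    \<comment> \<open>The point at level \<open>- k\<close> that \<open>a [^] k\<close> lifts to
      \<open>(0, 0)\<close>; it lies low enough to be fixed by \<open>B\<close>.\<close>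
    obtain t where t: "\<tau> (a [^]\<^bsub>Q\<^esub> (- k)) (0, 0) = (- k, t)"
      using level[of "a [^]\<^bsub>Q\<^esub> (- k)" 0 0] a_carrier by (cases "\<tau> (a [^]\<^bsub>Q\<^esub> (- k)) (0, 0)") (simp add: e_a_pow)
    have return: "\<tau> (a [^]\<^bsub>Q\<^esub> k) (- k, t) = (0, 0)" using conj[of k "(0, 0)"] by (simp add: t)
    have "\<tau> (a [^]\<^bsub>Q\<^esub> (- k) \<otimes>\<^bsub>Q\<^esub> g \<otimes>\<^bsub>Q\<^esub> a [^]\<^bsub>Q\<^esub> k) (- k, t) = (- k, t)"
      using B_trivial[OF b] k_ge by simp
    then have "\<tau> (a [^]\<^bsub>Q\<^esub> (- k)) (\<tau> g (0, 0)) = (- k, t)"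
      using a_carrier assms(1) by (simp add: \<tau>_mult return)
    then have "\<tau> g (0, 0) = (0, 0)"
      using conj[of k "\<tau> g (0, 0)"] return by simp
    then have "\<Lambda> g 0 = 0"
      using regular[OF w(1), of 0 0] unfolding w(2) by (simp add: K_def)
    then show False using \<Lambda> assms by (auto simp: regular_like_def)
  qed
  then show ?thesis by blast
qed

end

lemma (in graded_amalgam) finite_index_action:
  assumes "infinite \<Omega>" "countable \<Omega>" "subgroup H Q" "finite (rcosets\<^bsub>Q\<^esub> H)"
  shows "\<exists>\<psi>. transitive_faithful_amenable (Q\<lparr>carrier := H\<rparr>) \<Omega> \<psi>"
proof (rule group.coset_action_amenable[OF group_Q countable_Q subgroup_B a_carrier, of e])
  fix g assume "g \<in> carrier Q"
  then obtain w where w: "w \<in> words S" "g = eval_word Q \<iota> w" by (rule Q_cases)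
  then show "\<exists>k0::int. \<forall>k\<ge>k0. a [^]\<^bsub>Q\<^esub> k \<otimes>\<^bsub>Q\<^esub> g \<otimes>\<^bsub>Q\<^esub> a [^]\<^bsub>Q\<^esub> (- (k + e g)) \<in> B"
    using absorb_word[OF w(1)] by (intro exI[of _ "int (length w)"]) (simp add: e_eval)
qed (use assms in \<open>simp_all add: e_mult e_a e_B core_free\<close>)

theorem theorem14:
  fixes n m :: nat and \<Omega> :: "'x set"
    and c d :: "(nat \<times> bool) list"
  assumes "n \<ge> 1" and "m \<ge> 1"
    and "infinite \<Omega>" and "countable \<Omega>"
    and "c \<in> carrier (free_group {..n})" and "d \<in> carrier (free_group {..m})"
    and "cyclically_reduced c" and "cyclically_reduced d"
    and "\<not> primitive {..n} c" and "\<not> primitive {..m} d"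
    and "\<exists>a \<in> fst ` set c. exp_sum a c = 0"
    and "\<exists>a \<in> fst ` set d. exp_sum a d = 0"
  shows "(\<exists>\<phi>. transitive_faithful_amenable (amalgam_free n m c d) \<Omega> \<phi>)
       \<and> (\<forall>H. subgroup H (amalgam_free n m c d) \<and> finite (rcosets\<^bsub>amalgam_free n m c d\<^esub> H)
            \<longrightarrow> (\<exists>\<psi>. transitive_faithful_amenable ((amalgam_free n m c d)\<lparr>carrier := H\<rparr>) \<Omega> \<psi>))"
proof -
  obtain a0 where a0: "a0 \<in> fst ` set c" "exp_sum a0 c = 0" using assms(11) by blast
  have "a0 \<le> n" using a0(1) assms(5) by (auto simp: free_group_def)
  moreover have "c \<noteq> []" "d \<noteq> []" using assms(11,12) by auto
  ultimately interpret graded_amalgam n m c d a0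
    using assms(5,6) a0(2) by unfold_locales
  interpret Q: group "amalgam_free n m c d" by (rule group_Q)
  let ?Q = "amalgam_free n m c d"
  \<comment> \<open>The first claim is the case of the subgroup of index one.\<close>
  have "rcosets\<^bsub>?Q\<^esub> (carrier ?Q) \<subseteq> {carrier ?Q}"
    by (auto simp: RCOSETS_def Q.coset_join2 Q.subgroup_self)
  then have "finite (rcosets\<^bsub>?Q\<^esub> (carrier ?Q))" by (rule finite_subset) simp
  from finite_index_action[OF assms(3,4) Q.subgroup_self this]
  have "\<exists>\<phi>. transitive_faithful_amenable ?Q \<Omega> \<phi>" by simp
  then show ?thesis using finite_index_action[OF assms(3,4)] by blast
qed

end
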